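(* Let $\lambda\ge0$, $\sqrt Q=e^\lambda+e^{-\lambda}$, $L$ even and $\beta>0$. For every function $f:\{-1,1\}^{\Lambda_L}\to\mathbb R$ (viewed as the operator $f(\tau^z)$ diagonal in the $\tau^z$-basis), $$\langle f(\tau^z)\rangle^{(\mathrm{XXZ},+)}_{L,\beta,\lambda}=\int\mathbb E_+(f\mid\omega)\,\mu_{L,\beta}(d\omega),\qquad \langle f(\tau^z)\rangle^{(\mathrm{XXZ},-)}_{L,\beta,-\lambda}=\int\mathbb E_-(f\mid\omega)\,\mu_{L,\beta}(d\omega),$$ where $$\mathbb E_\pm(f\mid\omega)=\frac1{\sqrt Q^{\,N_\ell(\omega)}}\sum_\tau\mathbb 1[\omega,\tau]\,W_\pm(\omega,\tau)\,f(\tau(\cdot,0)),\qquad W_\pm(\omega,\tau)=\prod_{\ell\ \text{ccw}}e^{\pm\lambda}\prod_{\ell\ \text{cw}}e^{\mp\lambda},$$ the products running over counterclockwise, resp. clockwise, oriented loops $\ell$ of $(\omega,\tau)$.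
   Context: XXZ setup: Pauli matrices $\tau^\alpha$ on $\mathbb C^2$, $\tau^z|\pm\rangle=\pm|\pm\rangle$, $\Lambda_L=\{-L+1,\dots,L\}$, $\mathcal H_L=\bigotimes_{v\in\Lambda_L}\mathbb C^2$. $H^{(L)}_{\mathrm{XXZ}}=-\tfrac12\sum_{v=-L+1}^{L-1}[\tau^x_v\tau^x_{v+1}+\tau^y_v\tau^y_{v+1}-\cosh\lambda(\tau^z_v\tau^z_{v+1}-1)]$, $H^{(L,\pm)}_{\mathrm{XXZ}}=H^{(L)}_{\mathrm{XXZ}}\pm\sinh(\lambda)(-1)^L(\tau^z_{-L+1}-\tau^z_L)/2$. Seed $|N^{(L)}_\lambda\rangle=\bigotimes_{j=1}^L(e^{-\lambda/2}|+,-\rangle+e^{\lambda/2}|-,+\rangle)_{-L+2j-1,-L+2j}$, and $$\langle F\rangle^{(\mathrm{XXZ},\pm)}_{L,\beta,\lambda'}=\frac{\langle N^{(L)}_{\lambda'}|e^{-\beta H^{(L,\pm)}_{\mathrm{XXZ}}/2}Fe^{-\beta H^{(L,\pm)}_{\mathrm{XXZ}}/2}|N^{(L)}_{\lambda'}\rangle}{\langle N^{(L)}_{\lambda'}|e^{-\beta H^{(L,\pm)}_{\mathrm{XXZ}}}|N^{(L)}_{\lambda'}\rangle}.$$ Loop model: $\Lambda_{L,\beta}=\Lambda_L\times[-\beta/2,\beta/2]$. A rung configuration $\omega$ is a finite set of pairs $(b,t)$ with $b=\{u,u+1\}$, $-L+1\le u\le L-1$, $t\in(-\beta/2,\beta/2)$;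 $\rho_{\Lambda_{L,\beta}}$ is the law of independent Poisson point processes of intensity $dt$ on each of these $2L-1$ columns. Loops of $\omega$: draw the vertical segments $\{u\}\times[-\beta/2,\beta/2]$; replace each rung at edge $\{u,u+1\}$, time $t$, by two infinitesimally separated horizontal segments joining $u$ and $u+1$ just below and just above $t$, removing the piece of columns $u,u+1$ between them (so paths make U-turns at rungs); at $t=\beta/2$ and at $t=-\beta/2$ join the endpoints of columns $-L+2j-1$ and $-L+2j$ for $j=1,\dots,L$ (capping). The resulting set is a disjoint union of closed loops; $N_\ell(\omega)$ is their number. $\mu_{L,\beta}(d\omega)=\sqrt Q^{\,N_\ell(\omega)}\rho_{\Lambda_{L,\beta}}(d\omega)/\mathrm{Norm}$. A pseudo-spin configuration $\tau:\Lambda_{L,\beta}\to\{-1,1\}$ is constant in $t$ on each column except at rung times; $\mathbb 1[\omega,\tau]=1$ iff $\tau$ defines a consistent orientation of every loop (traversing vertical pieces upward where $\tau=+1$, downward where $\tau=-1$; equivalently $\tau$ is constant along vertical pieces and reverses at each U-turn). Each loop is then counterclockwise (ccw) or clockwise (cw). *)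

theory Defs
  imports "HOL-Analysis.Analysis"
begin

section \<open>Quantum side: the XXZ chain on Lambda_L = {-L+1..L}\<close>

definition sites :: "nat \<Rightarrow> int set" where
  "sites L = {- int L + 1 .. int L}"

text \<open>tau^z basis configurations: sigma v = 1 for |+>, -1 for |->, extended by 0 off Lambda_L.\<close>
definition confs :: "nat \<Rightarrow> (int \<Rightarrow> int) set" where
  "confs L = {\<sigma>. (\<forall>v\<in>sites L. \<sigma> v \<in> {-1, 1}) \<and> (\<forall>v. v \<notin> sites L \<longrightarrow> \<sigma> v = 0)}"

type_synonym op = "(int \<Rightarrow> int) \<Rightarrow> (int \<Rightarrow> int) \<Rightarrow> complex"

definition xxz_delta :: op where
  "xxz_delta x y = (if x = y then 1 else 0)"

definition xxz_mult :: "nat \<Rightarrow> op \<Rightarrow> op \<Rightarrow> op" where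
  "xxz_mult L A B = (\<lambda>x y. \<Sum>z\<in>confs L. A x z * B z y)"

fun xxz_pow :: "nat \<Rightarrow> op \<Rightarrow> nat \<Rightarrow> op" where
  "xxz_pow L A 0 = xxz_delta"
| "xxz_pow L A (Suc n) = xxz_mult L (xxz_pow L A n) A"

text \<open>Matrix exponential (entrywise sum of the exponential series).\<close>
definition xxz_exp :: "nat \<Rightarrow> op \<Rightarrow> op" where
  "xxz_exp L A = (\<lambda>x y. \<Sum>k. xxz_pow L A k x y / of_nat (fact k))"

datatype pauli_idx = PX | PY | PZ

text \<open>Matrix elements <s|tau^a|s'> on C^2, s, s' in {1,-1}.\<close>
fun pauli :: "pauli_idx \<Rightarrow> int \<Rightarrow> int \<Rightarrow> complex" where
  "pauli PX s s' = (if s \<noteq> s' then 1 else 0)"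
| "pauli PY s s' = (if s = 1 \<and> s' = -1 then - \<i> else if s = -1 \<and> s' = 1 then \<i> else 0)"
| "pauli PZ s s' = (if s = s' then of_int s else 0)"

definition site_op :: "pauli_idx \<Rightarrow> int \<Rightarrow> op" where
  "site_op a v x y = pauli a (x v) (y v) * (if (\<forall>u. u \<noteq> v \<longrightarrow> x u = y u) then 1 else 0)"

definition H_XXZ :: "nat \<Rightarrow> real \<Rightarrow> op" where
  "H_XXZ L lam x y = - (1/2) * (\<Sum>v\<in>{- int L + 1 .. int L - 1}.
      xxz_mult L (site_op PX v) (site_op PX (v+1)) x y
    + xxz_mult L (site_op PY v) (site_op PY (v+1)) x y
    - complex_of_real (cosh lam) * (xxz_mult L (site_op PZ v) (site_op PZ (v+1)) x y - xxz_delta x y))"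

text \<open>s = 1 gives H^(L,+), s = -1 gives H^(L,-).\<close>
definition H_XXZ_pm :: "nat \<Rightarrow> real \<Rightarrow> real \<Rightarrow> op" where
  "H_XXZ_pm L lam s x y = H_XXZ L lam x y
     + complex_of_real (s * sinh lam * (-1) ^ L) * (site_op PZ (- int L + 1) x y - site_op PZ (int L) x y) / 2"

definition pair_amp :: "real \<Rightarrow> int \<Rightarrow> int \<Rightarrow> complex" where
  "pair_amp l a b = (if a = 1 \<and> b = -1 then complex_of_real (exp (- l / 2))
                     else if a = -1 \<and> b = 1 then complex_of_real (exp (l / 2)) else 0)"

text \<open>Seed vector |N^(L)_lam'> in the tau^z basis.\<close>
definition seed :: "nat \<Rightarrow> real \<Rightarrow> (int \<Rightarrow> int) \<Rightarrow> complex" where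
  "seed L l \<sigma> = (\<Prod>j\<in>{1 .. int L}. pair_amp l (\<sigma> (- int L + 2*j - 1)) (\<sigma> (- int L + 2*j)))"

definition diag_op :: "((int \<Rightarrow> int) \<Rightarrow> real) \<Rightarrow> op" where
  "diag_op f x y = (if x = y then complex_of_real (f x) else 0)"

definition scale_op :: "real \<Rightarrow> op \<Rightarrow> op" where
  "scale_op c A x y = complex_of_real c * A x y"

definition bra_op_ket :: "nat \<Rightarrow> ((int \<Rightarrow> int) \<Rightarrow> complex) \<Rightarrow> op \<Rightarrow> complex" where
  "bra_op_ket L \<psi> A = (\<Sum>x\<in>confs L. \<Sum>y\<in>confs L. cnj (\<psi> x) * A x y * \<psi> y)"

text \<open>< F >^(XXZ,+-)_{L,beta,lam'}, with s = +-1 selecting H^(L,+-).\<close>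
definition xxz_expect :: "nat \<Rightarrow> real \<Rightarrow> real \<Rightarrow> real \<Rightarrow> real \<Rightarrow> op \<Rightarrow> complex" where
  "xxz_expect L \<beta> lam s l F =
     (let E = xxz_exp L (scale_op (- \<beta> / 2) (H_XXZ_pm L lam s));
          E2 = xxz_exp L (scale_op (- \<beta>) (H_XXZ_pm L lam s))
      in bra_op_ket L (seed L l) (xxz_mult L (xxz_mult L E F) E) / bra_op_ket L (seed L l) E2)"

section \<open>Loop model\<close>

text \<open>A rung (u,t) sits on the edge {u,u+1} at time t. Rung configurations are lists of rungs.\<close>
type_synonym rung = "int \<times> real"

definition edges :: "nat \<Rightarrow> int set" where
  "edges L = {- int L + 1 .. int L - 1}"

text \<open>Rung times touching column v, increasingly sorted.\<close>
definition col_times :: "rung list \<Rightarrow> int \<Rightarrow> real list" where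
  "col_times \<omega> v = sorted_list_of_set {t. \<exists>u. (u, t) \<in> set \<omega> \<and> (u = v \<or> u = v - 1)}"

text \<open>Vertical pieces: piece (v,i) of column v is the part between the (i-1)-th and i-th
  rung times touching v (with -beta/2 and beta/2 at the ends).\<close>
definition pieces :: "nat \<Rightarrow> rung list \<Rightarrow> (int \<times> nat) set" where
  "pieces L \<omega> = {(v, i). v \<in> sites L \<and> i \<le> length (col_times \<omega> v)}"

definition tidx :: "rung list \<Rightarrow> int \<Rightarrow> real \<Rightarrow> nat" where
  "tidx \<omega> v t = length (filter (\<lambda>s. s < t) (col_times \<omega> v))"

definition cap_cols :: "nat \<Rightarrow> int set" where
  "cap_cols L = {- int L + 2*j - 1 | j. 1 \<le> j \<and> j \<le> int L}"

text \<open>Links between piece ends: U-turns just below / just above each rung, and the caps.\<close>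
definition links :: "nat \<Rightarrow> rung list \<Rightarrow> ((int \<times> nat) \<times> (int \<times> nat)) set" where
  "links L \<omega> =
     {((u, tidx \<omega> u t), (u+1, tidx \<omega> (u+1) t)) | u t. (u, t) \<in> set \<omega>}
   \<union> {((u, Suc (tidx \<omega> u t)), (u+1, Suc (tidx \<omega> (u+1) t))) | u t. (u, t) \<in> set \<omega>}
   \<union> {((a, 0), (a+1, 0)) | a. a \<in> cap_cols L}
   \<union> {((a, length (col_times \<omega> a)), (a+1, length (col_times \<omega> (a+1)))) | a. a \<in> cap_cols L}"

text \<open>Loops = connected components of pieces under the links.\<close>
definition loops :: "nat \<Rightarrow> rung list \<Rightarrow> (int \<times> nat) set set" where
  "loops L \<omega> = pieces L \<omega> // ((links L \<omega> \<union> (links L \<omega>)\<inverse>)\<^sup>*)"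

definition num_loops :: "nat \<Rightarrow> rung list \<Rightarrow> nat" where
  "num_loops L \<omega> = card (loops L \<omega>)"

definition sqrtQ :: "real \<Rightarrow> real" where
  "sqrtQ lam = exp lam + exp (- lam)"

text \<open>Pseudo-spin configurations (values on vertical pieces).\<close>
definition pseudo_spins :: "nat \<Rightarrow> rung list \<Rightarrow> (int \<times> nat \<Rightarrow> int) set" where
  "pseudo_spins L \<omega> = {\<tau>. (\<forall>p\<in>pieces L \<omega>. \<tau> p \<in> {-1, 1}) \<and> (\<forall>p. p \<notin> pieces L \<omega> \<longrightarrow> \<tau> p = 0)}"

text \<open>1[omega,tau]: tau constant on vertical pieces and reversed across each U-turn/cap.\<close>
definition consistent :: "nat \<Rightarrow> rung list \<Rightarrow> (int \<times> nat \<Rightarrow> int) \<Rightarrow> bool" where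
  "consistent L \<omega> \<tau> = (\<forall>(p, q)\<in>links L \<omega>. \<tau> p = - \<tau> q)"

text \<open>A (Jordan) loop is counterclockwise iff its interior lies to the left of the direction
  of travel; on its leftmost vertical pieces the interior is to the right, so the loop is
  ccw iff it is traversed downward (tau = -1) there.\<close>
definition is_ccw :: "(int \<times> nat) set \<Rightarrow> (int \<times> nat \<Rightarrow> int) \<Rightarrow> bool" where
  "is_ccw C \<tau> = (\<forall>p\<in>C. fst p = Min (fst ` C) \<longrightarrow> \<tau> p = -1)"

text \<open>W_+- with s = +-1.\<close>
definition loop_weight :: "nat \<Rightarrow> real \<Rightarrow> real \<Rightarrow> rung list \<Rightarrow> (int \<times> nat \<Rightarrow> int) \<Rightarrow> real" where
  "loop_weight L lam s \<omega> \<tau> = (\<Prod>C\<in>loops L \<omega>. if is_ccw C \<tau> then exp (s * lam) else exp (- s * lam))"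

text \<open>tau(.,0): value on the piece of column v containing time 0.\<close>
definition spins_at_0 :: "nat \<Rightarrow> rung list \<Rightarrow> (int \<times> nat \<Rightarrow> int) \<Rightarrow> int \<Rightarrow> int" where
  "spins_at_0 L \<omega> \<tau> v = (if v \<in> sites L then \<tau> (v, tidx \<omega> v 0) else 0)"

definition cond_exp :: "nat \<Rightarrow> real \<Rightarrow> real \<Rightarrow> ((int \<Rightarrow> int) \<Rightarrow> real) \<Rightarrow> rung list \<Rightarrow> real" where
  "cond_exp L lam s f \<omega> = 1 / sqrtQ lam ^ num_loops L \<omega> *
     (\<Sum>\<tau>\<in>pseudo_spins L \<omega>. (if consistent L \<omega> \<tau> then 1 else 0)
        * loop_weight L lam s \<omega> \<tau> * f (spins_at_0 L \<omega> \<tau>))"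

text \<open>Integral against rho: independent rate-1 Poisson processes on the 2L-1 columns
  (-beta/2,beta/2); equivalently a Poisson number n of points with total intensity
  (2L-1) beta, placed iid uniformly on edges x times.\<close>
definition rho_int :: "nat \<Rightarrow> real \<Rightarrow> (rung list \<Rightarrow> real) \<Rightarrow> real" where
  "rho_int L \<beta> F = (\<Sum>n. exp (- (2 * real L - 1) * \<beta>) / fact n *
      (\<Sum>es\<in>{es. length es = n \<and> set es \<subseteq> edges L}.
         integral\<^sup>L (PiM {..<n} (\<lambda>_. restrict_space lborel {- \<beta> / 2 <..< \<beta> / 2}))
           (\<lambda>t. F (zip es (map t [0..<n])))))"

definition mu_int :: "nat \<Rightarrow> real \<Rightarrow> real \<Rightarrow> (rung list \<Rightarrow> real) \<Rightarrow> real" where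
  "mu_int L \<beta> lam F = rho_int L \<beta> (\<lambda>\<omega>. sqrtQ lam ^ num_loops L \<omega> * F \<omega>)
                       / rho_int L \<beta> (\<lambda>\<omega>. sqrtQ lam ^ num_loops L \<omega>)"

end

theory Submission
  imports Defs
begin

text \<open>With l = s * lam, the telescoping boundary term turns the Hamiltonian into minus a sum of rank-one
  bond operators |xi><xi|, where xi = exp(-l/2)|+,-> + exp(l/2)|-,+>, and the seed is a product of
  the same vectors xi. Expanding the exponentials, every matrix element becomes a sum over words of
  bonds, and each word is a sum over pseudo-spins in which every U-turn contributes exp(l/2) or
  exp(-l/2) according to its sense of rotation. Closed planar loops have total turning number one,
  so the U-turns of a loop multiply to exp(l) or exp(-l); this is shown by scanning the picture upwards
  in time and maintaining a noncrossing matching of the open strands. On the Poisson side the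
  integrand only depends on the relative order of the rung times, so summing over all edge labels
  removes the order, and only the number of rungs before time 0 remains, which is binomial.\<close>

section \<open>Turning numbers of planar loops\<close>

text \<open>The obstacle is that loops are given only as classes of linked pieces, so no curve is at
  hand to which a turning theorem could be applied. Two facts replace it. A link joins neighbouring
  columns, so a consistent orientation alternates with the parity of the column, and its signed
  number of U-turns is, up to one sign per loop, the sum over the links of the parity sign of the
  left column. Moreover the orientation is read off in the leftmost column, so it suffices that this
  sum is twice the parity sign of the leftmost column. Evenness of \<open>L\<close> fixes the sign
  of the boundary field, which then splits into s sinh(lam) (tau_u - tau_(u+1)) / 2 on the bonds.
  Time 0 cuts the time interval into halves of equal length \<beta>/2. Hence n rungs, k of them
  below 0, carry binom(n,k) (\<beta>/2)^n / n! = (\<beta>/2)^n / (k! (n-k)!), the coefficient in the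
  Cauchy product of the two exponentials. The Poisson normalization exp(-(2L-1)\<beta>) cancels in
  the quotient.\<close>

definition conn :: "('a \<times> 'a) list \<Rightarrow> ('a \<times> 'a) set" where
  "conn E = (set E \<union> (set E)\<inverse>)\<^sup>*"

definition component :: "('a \<times> 'a) list \<Rightarrow> 'a \<Rightarrow> 'a set" where
  "component E p = conn E `` {p}"

lemma conn_sym: "(x, y) \<in> conn E \<Longrightarrow> (y, x) \<in> conn E"
  unfolding conn_def by (metis Un_commute converse_Un converse_converse rtrancl_converseI)

lemma in_component_iff: "y \<in> component E x \<longleftrightarrow> (x, y) \<in> conn E"
  by (simp add: component_def)

lemma self_in_component [simp]: "x \<in> component E x"
  by (simp add: component_def conn_def)

lemma component_eq_iff: "component E x = component E y \<longleftrightarrow> y \<in> component E x"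
proof
  assume "y \<in> component E x"
  then have "(x, y) \<in> conn E" "(y, x) \<in> conn E"
    by (auto simp: in_component_iff intro: conn_sym)
  then show "component E x = component E y"
    unfolding component_def conn_def by (auto intro: rtrancl_trans)
qed (metis self_in_component)

lemma in_component_sym: "y \<in> component E x \<longleftrightarrow> x \<in> component E y"
  by (metis component_eq_iff self_in_component)

lemma component_disjoint: "component E x \<noteq> component E y \<Longrightarrow> component E x \<inter> component E y = {}"
  by (metis component_eq_iff disjoint_iff)

text \<open>A path that uses the new link repeatedly can be shortened to one that crosses it at most
  once; the disjuncts are no crossing and a crossing in either direction.\<close>

lemma conn_Cons: "(x, y) \<in> conn ((p, q) # E) \<longleftrightarrow>
   (x, y) \<in> conn E \<or> (x, p) \<in> conn E \<and> (q, y) \<in> conn E \<or> (x, q) \<in> conn E \<and> (p, y) \<in> conn E"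
proof -
  let ?r = "set E \<union> (set E)\<inverse>"
  have "set ((p, q) # E) \<union> (set ((p, q) # E))\<inverse> = insert (p, q) (insert (q, p) ?r)"
    by auto
  then have "conn ((p, q) # E) = (insert (p, q) (insert (q, p) ?r))\<^sup>*"
    by (simp add: conn_def)
  have tr: "(x, y) \<in> ?r\<^sup>*" if "(x, z) \<in> ?r\<^sup>*" "(z, y) \<in> ?r\<^sup>*" for z
    using that by (rule rtrancl_trans)
  from \<open>conn _ = _\<close> show ?thesis
    using tr[of p] tr[of q]
    by (simp only: conn_def rtrancl_insert mem_Collect_eq Un_iff prod.case rtrancl.rtrancl_refl simp_thms) blast
qed

text \<open>The case that \<open>p\<close> and \<open>q\<close> are already connected is included:
  the union is then the old component, which is what happens when an arc closes to a loop.\<close>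

lemma component_Cons:
  "component ((p, q) # E) x =
    (if x \<in> component E p \<union> component E q then component E p \<union> component E q else component E x)"
proof (rule set_eqI)
  fix y
  have "(a, b) \<in> conn E \<longleftrightarrow> component E a = component E b" for a b
    by (simp add: component_eq_iff in_component_iff)
  then show "y \<in> component ((p, q) # E) x \<longleftrightarrow>
      y \<in> (if x \<in> component E p \<union> component E q then component E p \<union> component E q else component E x)"
    by (auto simp: in_component_iff conn_Cons)
qed

lemma component_isolated:
  assumes "p \<notin> fst ` set E" "p \<notin> snd ` set E"
  shows "component E p = {p}"
proof -
  have "y = p" if "(p, y) \<in> (set E \<union> (set E)\<inverse>)\<^sup>*" for y
    using that by (induction rule: rtrancl_induct) (use assms in force)+
  then show ?thesis
    by (auto simp: component_def conn_def)
qed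

lemma component_subset:
  assumes "set E \<subseteq> A \<times> A" "p \<in> A"
  shows "component E p \<subseteq> A"
proof -
  have "y \<in> A" if "(p, y) \<in> (set E \<union> (set E)\<inverse>)\<^sup>*" for y
    using that
  proof (induction rule: rtrancl_induct)
    case (step y z)
    then show ?case using assms(1) by blast
  qed (rule assms(2))
  then show ?thesis
    by (auto simp: component_def conn_def)
qed

section \<open>Signed counts of U-turns and the invariant of the upward scan\<close>

definition col_sign :: "int \<Rightarrow> int" where
  "col_sign v = (if even v then 1 else - 1)"

text \<open>Both ends of a link lie in the same loop, so each link is counted once, through its left
  end \<open>p\<close>. Up to the orientation sign of the loop this is the signed number of its
  U-turns.\<close>

definition turning :: "((int \<times> nat) \<times> (int \<times> nat)) list \<Rightarrow> (int \<times> nat) set \<Rightarrow> int" where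
  "turning E C = (\<Sum>(p, q)\<leftarrow>E. if p \<in> C then col_sign (fst p) else 0)"

definition mincol :: "(int \<times> nat) set \<Rightarrow> int" where
  "mincol C = Min (fst ` C)"

lemma turning_Cons:
  "turning ((p, q) # E) C = (if p \<in> C then col_sign (fst p) else 0) + turning E C"
  by (simp add: turning_def)

lemma turning_disjoint:
  "fst ` set E \<inter> C = {} \<Longrightarrow> turning E C = 0"
  unfolding turning_def by (induction E) (auto simp: disjoint_iff)

lemma turning_Un:
  "C \<inter> D = {} \<Longrightarrow> turning E (C \<union> D) = turning E C + turning E D"
  unfolding turning_def by (induction E) (auto simp: disjoint_iff)

lemma mincol_Un:
  assumes "finite C" "finite D" "C \<noteq> {}" "D \<noteq> {}"
  shows "mincol (C \<union> D) = min (mincol C) (mincol D)"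
  using assms by (simp add: mincol_def image_Un Min_Un)

text \<open>Snapshot of a partially drawn loop picture: \<open>S\<close> are the columns with an open upper end, \<open>tip v\<close> is
  the piece at that end, and \<open>\<pi>\<close> matches the two ends of each arc. Besides the turning
  number, the invariant has to record that an enclosed arc never reaches as far left as the arc around
  it: this decides which of two merged arcs contributes the leftmost column.\<close>

locale planar_state =
  fixes S :: "int set" and A :: "(int \<times> nat) set"
    and E :: "((int \<times> nat) \<times> (int \<times> nat)) list"
    and tip :: "int \<Rightarrow> int \<times> nat" and \<pi> :: "int \<Rightarrow> int"
  assumes finA: "finite A"
    and EA: "set E \<subseteq> A \<times> A"
    and topA: "v \<in> S \<Longrightarrow> tip v \<in> A"
    and fst_top: "v \<in> S \<Longrightarrow> fst (tip v) = v"
    and partner_in: "v \<in> S \<Longrightarrow> \<pi> v \<in> S"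
    and partner_inv: "v \<in> S \<Longrightarrow> \<pi> (\<pi> v) = v"
    and partner_odd: "v \<in> S \<Longrightarrow> odd (\<pi> v - v)"
    and top_comp: "v \<in> S \<Longrightarrow> w \<in> S \<Longrightarrow> tip w \<in> component E (tip v) \<longleftrightarrow> w = v \<or> w = \<pi> v"
    and noncross: "v \<in> S \<Longrightarrow> w \<in> S \<Longrightarrow> v < w \<Longrightarrow> w < \<pi> v \<Longrightarrow> v < \<pi> w \<and> \<pi> w < \<pi> v"
    and arc_turning: "v \<in> S \<Longrightarrow> v < \<pi> v \<Longrightarrow> turning E (component E (tip v)) = col_sign v"
    and arc_mincol: "v \<in> S \<Longrightarrow> v < \<pi> v \<Longrightarrow> col_sign (mincol (component E (tip v))) = col_sign v"
    and nested: "v \<in> S \<Longrightarrow> w \<in> S \<Longrightarrow> v < w \<Longrightarrow> w < \<pi> w \<Longrightarrow> \<pi> w < \<pi> v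
      \<Longrightarrow> mincol (component E (tip v)) < mincol (component E (tip w))"
    and closed: "p \<in> A \<Longrightarrow> (\<And>v. v \<in> S \<Longrightarrow> tip v \<notin> component E p)
      \<Longrightarrow> turning E (component E p) = 2 * col_sign (mincol (component E p))"
begin

lemma fin_comp: "p \<in> A \<Longrightarrow> finite (component E p)"
  using component_subset[OF EA] finA finite_subset by blast

lemma mincol_le: "v \<in> S \<Longrightarrow> mincol (component E (tip v)) \<le> v"
  unfolding mincol_def using fin_comp[OF topA] fst_top
  by (intro Min_le) (auto simp: rev_image_eqI[OF self_in_component])

lemma partner_neq: "v \<in> S \<Longrightarrow> \<pi> v \<noteq> v"
  using partner_odd by fastforce

lemma comp_partner: "v \<in> S \<Longrightarrow> component E (tip (\<pi> v)) = component E (tip v)"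
  using top_comp partner_in component_eq_iff by metis

text \<open>Two neighbouring ends have no column between them, so they form an innermost arc that
  crosses nothing. Its leftmost column is \<open>u\<close> itself, while an arc around it starts
  further left and reaches at least to its own left end (\<open>mincol_le\<close>); this gives
  \<open>nested\<close>. Its single link has the turning required of an arc that starts at
  \<open>u\<close>.\<close>

lemma cup:
  assumes u: "u \<notin> S" "u + 1 \<notin> S" and new: "(u, i) \<notin> A" "(u + 1, j) \<notin> A"
  shows "planar_state (insert u (insert (u + 1) S)) (insert (u, i) (insert (u + 1, j) A))
     (((u, i), (u + 1, j)) # E) (tip(u := (u, i), u + 1 := (u + 1, j))) (\<pi>(u := u + 1, u + 1 := u))"
proof -
  let ?E = "((u, i), (u + 1, j)) # E" and ?t = "tip(u := (u, i), u + 1 := (u + 1, j))"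
  let ?\<pi> = "\<pi>(u := u + 1, u + 1 := u)"
  have iso: "component E (u, i) = {(u, i)}" "component E (u + 1, j) = {(u + 1, j)}"
    by (rule component_isolated; use EA new in force)+
  have new_comp: "component ?E (u, i) = {(u, i), (u + 1, j)}" "component ?E (u + 1, j) = {(u, i), (u + 1, j)}"
    by (auto simp: component_Cons iso)
  have old_comp: "component ?E p = component E p" if "p \<in> A" for p
    using that new by (auto simp: component_Cons iso)
  have notin: "(u, i) \<notin> component E p" "(u + 1, j) \<notin> component E p" if "p \<in> A" for p
    using component_subset[OF EA that] new by auto
  have new_turn: "turning ?E {(u, i), (u + 1, j)} = col_sign u"
  proof -
    have "fst ` set E \<inter> {(u, i), (u + 1, j)} = {}"
      using new EA by fastforce
    then show ?thesis by (simp add: turning_Cons turning_disjoint)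
  qed
  have old_turn: "turning ?E (component E p) = turning E (component E p)" if "p \<in> A" for p
    using notin[OF that] by (simp add: turning_Cons)
  have new_min: "mincol {(u, i), (u + 1, j)} = u"
    by (simp add: mincol_def)
  have old: "v \<noteq> u" "v \<noteq> u + 1" "\<pi> v \<noteq> u" "\<pi> v \<noteq> u + 1" "?\<pi> v = \<pi> v" "?t v = tip v" "tip v \<in> A"
    if "v \<in> S" for v
    using that u partner_in[OF that] topA[OF that] by auto
  show ?thesis
  proof
    show "finite (insert (u, i) (insert (u + 1, j) A))" using finA by simp
    show "set ?E \<subseteq> insert (u, i) (insert (u + 1, j) A) \<times> insert (u, i) (insert (u + 1, j) A)"
      using subset_trans[OF EA Sigma_mono, of "insert (u, i) (insert (u + 1, j) A)" "\<lambda>_. insert (u, i) (insert (u + 1, j) A)"]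
      by (simp add: subset_insertI2)
  next
    fix v assume "v \<in> insert u (insert (u + 1) S)"
    then show "?t v \<in> insert (u, i) (insert (u + 1, j) A)" "fst (?t v) = v"
      "?\<pi> v \<in> insert u (insert (u + 1) S)" "?\<pi> (?\<pi> v) = v" "odd (?\<pi> v - v)"
      using old[of v] topA[of v] fst_top[of v] partner_in[of v] partner_inv[of v] partner_odd[of v]
      by (cases "v \<in> S"; auto)+
  next
    fix v w assume "v \<in> insert u (insert (u + 1) S)" "w \<in> insert u (insert (u + 1) S)"
    then consider "v = u \<or> v = u + 1" "w = u \<or> w = u + 1" | "v = u \<or> v = u + 1" "w \<in> S"
      | "v \<in> S" "w = u \<or> w = u + 1" | "v \<in> S" "w \<in> S" by blast
    then show "?t w \<in> component ?E (?t v) \<longleftrightarrow> w = v \<or> w = ?\<pi> v"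
    proof cases
      case 1 then show ?thesis using new_comp by auto
    next
      case 2 then show ?thesis using new_comp old[OF 2(2)] new by auto
    next
      case 3 then show ?thesis using old[OF 3(1)] old_comp[OF old(7)[OF 3(1)]] notin[OF old(7)[OF 3(1)]] by auto
    next
      case 4 then show ?thesis using old[OF 4(1)] old[OF 4(2)] old_comp[OF old(7)[OF 4(1)]] top_comp[OF 4] by simp
    qed
    {
      assume "v < w" "w < ?\<pi> v"
      then show "v < ?\<pi> w \<and> ?\<pi> w < ?\<pi> v"
        using \<open>v \<in> _\<close> \<open>w \<in> _\<close> old[of v] old[of w] noncross[of v w]
        by (cases "v \<in> S"; cases "w \<in> S") auto
    }
    {
      assume *: "v < w" "w < ?\<pi> w" "?\<pi> w < ?\<pi> v"
      \<comment> \<open>No column lies strictly between \<open>u\<close> and \<open>u + 1\<close>,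
        so of two nested arcs the new one can only be the inner one.\<close>
      then have "v \<in> S" using \<open>v \<in> _\<close> \<open>w \<in> _\<close> old[of w] by (auto split: if_splits)
      then have v: "?t v = tip v" "?\<pi> v = \<pi> v" "tip v \<in> A" using old by auto
      show "mincol (component ?E (?t v)) < mincol (component ?E (?t w))"
      proof (cases "w \<in> S")
        case True
        then show ?thesis using * nested[OF \<open>v \<in> S\<close> True] v old[OF True] old_comp by simp
      next
        case False
        then have "w = u" using * \<open>w \<in> _\<close> by auto
        then show ?thesis using * mincol_le[OF \<open>v \<in> S\<close>] v old_comp[OF v(3)] by (simp add: new_comp new_min)
      qed
    }
  next
    fix v assume *: "v \<in> insert u (insert (u + 1) S)" "v < ?\<pi> v"
    show "turning ?E (component ?E (?t v)) = col_sign v"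
      using * old[of v] old_comp[of "tip v"] old_turn[of "tip v"] arc_turning[of v] new_comp new_turn by auto
    show "col_sign (mincol (component ?E (?t v))) = col_sign v"
      using * old[of v] old_comp[of "tip v"] arc_mincol[of v] new_comp new_min by auto
  next
    fix p assume p: "p \<in> insert (u, i) (insert (u + 1, j) A)"
      and *: "\<And>v. v \<in> insert u (insert (u + 1) S) \<Longrightarrow> ?t v \<notin> component ?E p"
    have "p \<in> A" using p *[of u] new_comp by auto
    moreover have "tip v \<notin> component E p" if "v \<in> S" for v
      using *[of v] that old[OF that] old_comp[OF \<open>p \<in> A\<close>] by auto
    ultimately show "turning ?E (component ?E p) = 2 * col_sign (mincol (component ?E p))"
      using closed old_comp old_turn by simp
  qed
qed

text \<open>If the two ends are partners, the arc closes: its turning \<open>col_sign u\<close> and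
  the sign \<open>col_sign u\<close> of the closing link add up, and \<open>arc_mincol\<close>
  identifies this sign with that of the leftmost column. Otherwise two arcs merge and their far ends
  become partners. The arcs lie side by side or one inside the other, and in each position the three
  signs add up to that of the new left end.\<close>

lemma cap:
  assumes u: "u \<in> S" "u + 1 \<in> S"
  shows "planar_state (S - {u, u + 1}) A ((tip u, tip (u + 1)) # E) tip
     (if \<pi> u = u + 1 then \<pi> else \<pi>(\<pi> u := \<pi> (u + 1), \<pi> (u + 1) := \<pi> u))"
proof (cases "\<pi> u = u + 1")
  case True
  let ?E = "(tip u, tip (u + 1)) # E"
  have same: "component E (tip (u + 1)) = component E (tip u)" using comp_partner[OF u(1)] True by simp
  have eq: "component ?E p = component E p" for p
    using same component_eq_iff[of E "tip u" p] by (auto simp: component_Cons)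
  have pu: "\<pi> (u + 1) = u" using partner_inv[OF u(1)] True by simp
  have old: "\<pi> v \<noteq> u" "\<pi> v \<noteq> u + 1" if "v \<in> S" "v \<noteq> u" "v \<noteq> u + 1" for v
    using that partner_inv[OF that(1)] True pu by auto
  have notin: "tip u \<notin> component E (tip v)" if "v \<in> S" "v \<noteq> u" "v \<noteq> u + 1" for v
    using top_comp[OF that(1) u(1)] old[OF that] that by auto
  have "planar_state (S - {u, u + 1}) A ?E tip \<pi>"
  proof
    show "finite A" by (rule finA)
    show "set ?E \<subseteq> A \<times> A" using EA topA u by simp
  next
    fix v assume "v \<in> S - {u, u + 1}"
    then show "tip v \<in> A" "fst (tip v) = v" "\<pi> v \<in> S - {u, u + 1}" "\<pi> (\<pi> v) = v" "odd (\<pi> v - v)"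
      using old topA fst_top partner_in partner_inv partner_odd by auto
  next
    fix v w assume "v \<in> S - {u, u + 1}" "w \<in> S - {u, u + 1}"
    then show "tip w \<in> component ?E (tip v) \<longleftrightarrow> w = v \<or> w = \<pi> v"
      "v < w \<Longrightarrow> w < \<pi> v \<Longrightarrow> v < \<pi> w \<and> \<pi> w < \<pi> v"
      "v < w \<Longrightarrow> w < \<pi> w \<Longrightarrow> \<pi> w < \<pi> v \<Longrightarrow> mincol (component ?E (tip v)) < mincol (component ?E (tip w))"
      using top_comp noncross nested by (auto simp: eq)
  next
    fix v assume "v \<in> S - {u, u + 1}" "v < \<pi> v"
    then show "turning ?E (component ?E (tip v)) = col_sign v"
      "col_sign (mincol (component ?E (tip v))) = col_sign v"
      using arc_turning arc_mincol notin by (auto simp: eq turning_Cons)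
  next
    fix p assume p: "p \<in> A" and *: "\<And>v. v \<in> S - {u, u + 1} \<Longrightarrow> tip v \<notin> component ?E p"
    show "turning ?E (component ?E p) = 2 * col_sign (mincol (component ?E p))"
    proof (cases "tip u \<in> component E p")
      case t: True
      then have "component E p = component E (tip u)" using component_eq_iff by metis
      then show ?thesis
        using arc_turning[OF u(1)] arc_mincol[OF u(1)] True fst_top[OF u(1)] by (simp add: eq turning_Cons)
    next
      case False
      then have "tip (u + 1) \<notin> component E p" using same component_eq_iff in_component_sym by metis
      then have "tip v \<notin> component E p" if "v \<in> S" for v
        using *[of v] that False by (auto simp: eq)
      then show ?thesis using closed[OF p] False by (simp add: eq turning_Cons)
    qed
  qed
  then show ?thesis using True by simp
next
  case ne: False
  let ?E = "(tip u, tip (u + 1)) # E"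
  define a where "a = \<pi> u"
  define b where "b = \<pi> (u + 1)"
  let ?\<pi> = "\<pi>(a := b, b := a)"
  let ?U = "component E (tip u)" and ?V = "component E (tip (u + 1))"
  have ab: "a \<in> S" "b \<in> S" "\<pi> a = u" "\<pi> b = u + 1" "a \<noteq> u" "b \<noteq> u + 1" "a \<noteq> u + 1" "b \<noteq> u" "a \<noteq> b"
  proof -
    show "a \<in> S" "b \<in> S" "\<pi> a = u" "\<pi> b = u + 1" "a \<noteq> u" "b \<noteq> u + 1"
      using u partner_in partner_inv partner_neq by (auto simp: a_def b_def)
    then show "a \<noteq> u + 1" "b \<noteq> u" "a \<noteq> b" using ne partner_inv[OF u(2)] by (auto simp: a_def b_def)
  qed
  have odd_ab: "odd (a - b)"
    using partner_odd[OF u(1)] partner_odd[OF u(2)] unfolding a_def b_def by presburger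
  have compa: "component E (tip a) = ?U" "component E (tip b) = ?V"
    using comp_partner u unfolding a_def b_def by auto
  have UV: "?U \<noteq> ?V" using top_comp[OF u] ne component_eq_iff by auto
  have dj: "?U \<inter> ?V = {}" using component_disjoint[OF UV] .
  have Ecomp: "component ?E p = (if p \<in> ?U \<union> ?V then ?U \<union> ?V else component E p)" for p
    by (rule component_Cons)
  have old: "\<pi> v \<noteq> u" "\<pi> v \<noteq> u + 1" "\<pi> v \<noteq> a" "\<pi> v \<noteq> b" "?\<pi> v = \<pi> v" "tip v \<notin> ?U" "tip v \<notin> ?V"
       "component ?E (tip v) = component E (tip v)" "tip u \<notin> component E (tip v)"
    if "v \<in> S" "v \<noteq> u" "v \<noteq> u + 1" "v \<noteq> a" "v \<noteq> b" for v
  proof -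
    show "\<pi> v \<noteq> u" "\<pi> v \<noteq> u + 1" "\<pi> v \<noteq> a" "\<pi> v \<noteq> b" "?\<pi> v = \<pi> v"
      using that ab partner_inv[OF that(1)] by (auto simp: a_def b_def)
    show *: "tip v \<notin> ?U" "tip v \<notin> ?V"
      using top_comp[OF u(1) that(1)] top_comp[OF u(2) that(1)] that by (auto simp: a_def b_def)
    then show "component ?E (tip v) = component E (tip v)" by (simp add: Ecomp)
    show "tip u \<notin> component E (tip v)" using * in_component_sym by metis
  qed
  have tab: "tip a \<in> ?U" "tip b \<in> ?V" using compa self_in_component by metis+
  have newc: "component ?E (tip a) = ?U \<union> ?V" "component ?E (tip b) = ?U \<union> ?V"
    using tab by (auto simp: Ecomp)
  have mUV: "mincol (?U \<union> ?V) = min (mincol ?U) (mincol ?V)"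
    using fin_comp[OF topA[OF u(1)]] fin_comp[OF topA[OF u(2)]] self_in_component[of "tip u" E] self_in_component[of "tip (u + 1)" E]
    by (intro mincol_Un) (auto simp del: self_in_component)
  have "tip u \<notin> ?V" using dj self_in_component[of "tip u" E] by blast
  then have tUV: "turning ?E (?U \<union> ?V) = col_sign u + turning E ?U + turning E ?V"
    using fst_top[OF u(1)] by (simp add: turning_Cons turning_Un[OF dj])
  \<comment> \<open>The ends of an arc lie in columns of opposite parity, so among the three signs
    that make up \<open>tUV\<close> two always cancel.\<close>
  have par: "col_sign a = - col_sign u" "col_sign b = col_sign u" "col_sign (u + 1) = - col_sign u"
    using partner_odd[OF u(1)] partner_odd[OF u(2)] unfolding a_def b_def col_sign_def by auto
  \<comment> \<open>Noncrossing leaves three positions: side by side, the arc of \<open>u\<close>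
    inside that of \<open>u + 1\<close>, and the reverse.\<close>
  have order: "a < u \<and> u + 1 < b \<or> b < a \<and> a < u \<or> u + 1 < b \<and> b < a"
  proof -
    have "u + 1 < a \<Longrightarrow> u < b \<and> b < a" using noncross[OF u] by (simp add: a_def b_def)
    moreover have "b < u \<Longrightarrow> b < a" using noncross[OF ab(2) u(1)] ab(4) by (simp add: a_def)
    ultimately show ?thesis using ab(5-8) by linarith
  qed
  define m where "m = min a b"
  have arc_new: "turning ?E (?U \<union> ?V) = col_sign m"
    "col_sign (mincol (?U \<union> ?V)) = col_sign m"
    and mincol_new: "a < u \<and> u + 1 < b \<or> b < a \<and> a < u \<and> mincol (?U \<union> ?V) = mincol ?V
         \<or> u + 1 < b \<and> b < a \<and> mincol (?U \<union> ?V) = mincol ?U"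
  proof -
    consider "a < u" "u + 1 < b" | "b < a" "a < u" | "u + 1 < b" "b < a" using order by blast
    then have "turning ?E (?U \<union> ?V) = col_sign m \<and>
      col_sign (mincol (?U \<union> ?V)) = col_sign m \<and> (a < u \<and> u + 1 < b \<or> b < a \<and> a < u \<and> mincol (?U \<union> ?V) = mincol ?V
         \<or> u + 1 < b \<and> b < a \<and> mincol (?U \<union> ?V) = mincol ?U)"
    proof cases
      \<comment> \<open>Side by side, the leftmost columns of the two arcs have the same parity, so
        it does not matter which of them is smaller.\<close>
      case 1
      then show ?thesis
        using arc_turning[OF ab(1)] arc_turning[OF u(2)] arc_mincol[OF ab(1)] arc_mincol[OF u(2)] ab par
        by (auto simp: m_def tUV mUV compa b_def[symmetric] min_def)
    next
      case 2
      \<comment> \<open>For nested arcs the two leftmost columns have opposite parity, so one must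
        know that the enclosing arc reaches further left; this is the purpose of
        \<open>nested\<close>.\<close>
      then have "mincol ?V < mincol ?U"
        using nested[OF ab(2) ab(1)] ab compa by simp
      with 2 show ?thesis
        using arc_turning[OF ab(1)] arc_turning[OF ab(2)] arc_mincol[OF ab(2)] ab par
        by (auto simp: m_def tUV mUV compa min_def)
    next
      case 3
      then have "mincol ?U < mincol ?V"
        using nested[OF u] by (simp add: a_def b_def)
      with 3 show ?thesis
        using arc_turning[OF u(1)] arc_turning[OF u(2)] arc_mincol[OF u(1)] ab par
        by (auto simp: m_def tUV mUV a_def[symmetric] b_def[symmetric] min_def)
    qed
    then show "turning ?E (?U \<union> ?V) = col_sign m"
      "col_sign (mincol (?U \<union> ?V)) = col_sign m"
      "a < u \<and> u + 1 < b \<or> b < a \<and> a < u \<and> mincol (?U \<union> ?V) = mincol ?V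
         \<or> u + 1 < b \<and> b < a \<and> mincol (?U \<union> ?V) = mincol ?U" by blast+
  qed
  have split: "v = a \<or> v = b \<or> v \<in> S \<and> v \<noteq> u \<and> v \<noteq> u + 1 \<and> v \<noteq> a \<and> v \<noteq> b" if "v \<in> S - {u, u + 1}" for v
    using that by auto
  have "planar_state (S - {u, u + 1}) A ?E tip ?\<pi>"
  proof
    show "finite A" by (rule finA)
    show "set ?E \<subseteq> A \<times> A" using EA topA u by simp
  next
    fix v assume v: "v \<in> S - {u, u + 1}"
    then show "tip v \<in> A" "fst (tip v) = v" using topA fst_top by auto
    show "?\<pi> v \<in> S - {u, u + 1}" "?\<pi> (?\<pi> v) = v" "odd (?\<pi> v - v)"
    proof (atomize(full), cases "v = a \<or> v = b")
      case True
      then show "?\<pi> v \<in> S - {u, u + 1} \<and> ?\<pi> (?\<pi> v) = v \<and> odd (?\<pi> v - v)"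
        using ab odd_ab by auto
    next
      case False
      then show "?\<pi> v \<in> S - {u, u + 1} \<and> ?\<pi> (?\<pi> v) = v \<and> odd (?\<pi> v - v)"
        using v old[of v] partner_in[of v] partner_inv[of v] partner_odd[of v] by simp
    qed
  next
    fix v w assume v: "v \<in> S - {u, u + 1}" and w: "w \<in> S - {u, u + 1}"
    let ?old = "\<lambda>v. v \<in> S \<and> v \<noteq> u \<and> v \<noteq> u + 1 \<and> v \<noteq> a \<and> v \<noteq> b"
    consider (nn) "v = a \<or> v = b" "w = a \<or> w = b" | (no) "v = a \<or> v = b" "?old w"
      | (on) "?old v" "w = a \<or> w = b" | (oo) "?old v" "?old w"
      using split[OF v] split[OF w] by blast
    note cases = this
    from cases show "tip w \<in> component ?E (tip v) \<longleftrightarrow> w = v \<or> w = ?\<pi> v"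
    proof cases
      case nn
      then show ?thesis using newc tab ab by auto
    next
      case no
      then show ?thesis using newc old[of w] ab by auto
    next
      case on
      then show ?thesis using old[of v] top_comp[of v w] ab by auto
    next
      case oo
      then show ?thesis using old[of v] top_comp[of v w] by auto
    qed
    show "v < ?\<pi> w \<and> ?\<pi> w < ?\<pi> v" if vw: "v < w" "w < ?\<pi> v"
      using cases
    proof cases
      case nn
      then show ?thesis using vw ab by auto
    next
      case no
      then have w': "w \<in> S" "\<pi> w \<in> S" "\<pi> (\<pi> w) = w" "?\<pi> w = \<pi> w" "\<pi> w \<noteq> u" "\<pi> w \<noteq> u + 1" "\<pi> w \<noteq> a" "\<pi> w \<noteq> b"
        "w \<noteq> u" "w \<noteq> u + 1" "w \<noteq> a" "w \<noteq> b"
        using old[of w] partner_in partner_inv by auto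
      note nc = noncross[OF ab(1) w'(1)] noncross[OF ab(2) w'(1)] noncross[OF u(1) w'(1)] noncross[OF u(2) w'(1)]
        noncross[OF ab(1) w'(2)] noncross[OF ab(2) w'(2)] noncross[OF u(1) w'(2)] noncross[OF u(2) w'(2)]
      have "v = a \<and> ?\<pi> v = b \<or> v = b \<and> ?\<pi> v = a" using no ab by auto
      then show ?thesis
        using nc[unfolded ab(3,4) a_def[symmetric] b_def[symmetric] w'(3)] w' vw order
        by (smt (verit))
    next
      case on
      then have v': "v \<in> S" "?\<pi> v = \<pi> v" "\<pi> v \<noteq> u" "\<pi> v \<noteq> u + 1" "v \<noteq> u" "v \<noteq> u + 1"
        using old[of v] by auto
      note nc = noncross[OF v'(1) ab(1)] noncross[OF v'(1) ab(2)] noncross[OF v'(1) u(1)] noncross[OF v'(1) u(2)]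
      have "w = a \<and> ?\<pi> w = b \<or> w = b \<and> ?\<pi> w = a" using on ab by auto
      then show ?thesis
        using nc[unfolded ab(3,4) a_def[symmetric] b_def[symmetric]] v' vw
        by (smt (verit))
    next
      case oo
      then show ?thesis using vw old[of v] old[of w] noncross[of v w] by auto
    qed
    show "mincol (component ?E (tip v)) < mincol (component ?E (tip w))"
      if vw: "v < w" "w < ?\<pi> w" "?\<pi> w < ?\<pi> v"
      using cases
    proof cases
      case nn
      then show ?thesis using vw ab by auto
    next
      case no
      then have w': "w \<in> S" "\<pi> w \<in> S" "\<pi> (\<pi> w) = w" "?\<pi> w = \<pi> w" "\<pi> w \<noteq> u" "\<pi> w \<noteq> u + 1" "\<pi> w \<noteq> a" "\<pi> w \<noteq> b"
        "w \<noteq> u" "w \<noteq> u + 1" "w \<noteq> a" "w \<noteq> b" "component ?E (tip w) = component E (tip w)"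
        using old[of w] partner_in partner_inv by auto
      have v': "v = a \<and> ?\<pi> v = b \<or> v = b \<and> ?\<pi> v = a" "component ?E (tip v) = ?U \<union> ?V" using no ab newc by auto
      note ne = nested[OF ab(1) w'(1), unfolded compa] nested[OF ab(2) w'(1), unfolded compa] nested[OF u(1) w'(1)] nested[OF u(2) w'(1)]
      note nc = noncross[OF ab(1) w'(1)] noncross[OF u(2) w'(1)]
      \<comment> \<open>An arc inside the merged one was already inside one of the two old arcs, and
        the minimum over the merged arc can only be smaller.\<close>
      have "mincol ?U < mincol (component E (tip w)) \<or> mincol ?V < mincol (component E (tip w))"
        using ne[unfolded ab(3,4) a_def[symmetric] b_def[symmetric]]
         nc[unfolded ab(3,4) a_def[symmetric] b_def[symmetric]] w' vw order v'(1)
        by (smt (verit))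
      then show ?thesis by (auto simp: v'(2) w' mUV)
    next
      case on
      then have v': "v \<in> S" "?\<pi> v = \<pi> v" "\<pi> v \<noteq> u" "\<pi> v \<noteq> u + 1" "v \<noteq> u" "v \<noteq> u + 1"
         "component ?E (tip v) = component E (tip v)"
        using old[of v] by auto
      have w': "w = a \<and> ?\<pi> w = b \<or> w = b \<and> ?\<pi> w = a" "component ?E (tip w) = ?U \<union> ?V" using on ab newc by auto
      note ne = nested[OF v'(1) ab(1), unfolded compa] nested[OF v'(1) ab(2), unfolded compa] nested[OF v'(1) u(1)] nested[OF v'(1) u(2)]
      note nc = noncross[OF v'(1) ab(1)] noncross[OF v'(1) ab(2)] noncross[OF v'(1) u(1)] noncross[OF v'(1) u(2)]
      \<comment> \<open>By noncrossing, an arc around the merged one was around each of the two old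
        arcs.\<close>
      have "mincol (component E (tip v)) < mincol ?U \<and> mincol (component E (tip v)) < mincol ?V"
        using ne[unfolded ab(3,4) a_def[symmetric] b_def[symmetric]]
         nc[unfolded ab(3,4) a_def[symmetric] b_def[symmetric]] w'(1) vw order v' ab(5-9)
        by (smt (verit))
      then show ?thesis by (auto simp: v'(7) w' mUV)
    next
      case oo
      then show ?thesis using vw old[of v] old[of w] nested[of v w] by auto
    qed
  next
    fix v assume v: "v \<in> S - {u, u + 1}" "v < ?\<pi> v"
    show "turning ?E (component ?E (tip v)) = col_sign v"
      "col_sign (mincol (component ?E (tip v))) = col_sign v"
      using split[OF v(1)] v(2) old[of v] ab newc arc_new arc_turning[of v] arc_mincol[of v]
      by (auto simp: m_def turning_Cons)
  next
    fix p assume p: "p \<in> A" and *: "\<And>v. v \<in> S - {u, u + 1} \<Longrightarrow> tip v \<notin> component ?E p"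
    have nU: "p \<notin> ?U \<union> ?V" using *[of a] ab tab by (auto simp: Ecomp)
    then have c: "component ?E p = component E p" by (simp add: Ecomp)
    have "tip u \<notin> component E p" "tip (u + 1) \<notin> component E p"
      using nU by (simp_all add: in_component_sym[of "tip u"] in_component_sym[of "tip (u + 1)"])
    moreover from this have "tip v \<notin> component E p" if "v \<in> S" for v
      using *[of v] that c by auto
    ultimately show "turning ?E (component ?E p) = 2 * col_sign (mincol (component ?E p))"
      using closed[OF p] by (simp add: c turning_Cons)
  qed
  then show ?thesis using ne by (simp add: a_def b_def)
qed

end

section \<open>The Hamiltonian as a sum of rank-one bond operators\<close>

definition bond :: "int \<Rightarrow> (int \<Rightarrow> int) \<Rightarrow> (int \<Rightarrow> int) \<Rightarrow> bool" where
  "bond u x y \<longleftrightarrow> (\<forall>v. v \<noteq> u \<and> v \<noteq> u + 1 \<longrightarrow> x v = y v)"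

text \<open>Agrees with the matrix \<open>pair_amp\<close> on signs only: \<open>amp l 0 0 = 1\<close>.\<close>

definition amp :: "real \<Rightarrow> int \<Rightarrow> int \<Rightarrow> real" where
  "amp l a b = (if a = - b then exp (- l * of_int a / 2) else 0)"

text \<open>Matrix element of |xi><xi| on the sites \<open>u\<close> and \<open>u + 1\<close>,
  tensored with the identity: a Temperley-Lieb generator with loop value <xi|xi> = exp(l) +
  exp(-l).\<close>

definition tl_gen :: "real \<Rightarrow> int \<Rightarrow> (int \<Rightarrow> int) \<Rightarrow> (int \<Rightarrow> int) \<Rightarrow> real" where
  "tl_gen l u x y = (if bond u x y then amp l (x u) (x (u + 1)) * amp l (y u) (y (u + 1)) else 0)"

definition tl_act :: "nat \<Rightarrow> real \<Rightarrow> int \<Rightarrow> ((int \<Rightarrow> int) \<Rightarrow> real) \<Rightarrow> (int \<Rightarrow> int) \<Rightarrow> real" where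
  "tl_act L l u \<phi> x = (\<Sum>y\<in>confs L. tl_gen l u x y * \<phi> y)"

definition tl_sum :: "nat \<Rightarrow> real \<Rightarrow> ((int \<Rightarrow> int) \<Rightarrow> real) \<Rightarrow> (int \<Rightarrow> int) \<Rightarrow> real" where
  "tl_sum L l \<phi> x = (\<Sum>u\<in>edges L. tl_act L l u \<phi> x)"

definition seed_re :: "nat \<Rightarrow> real \<Rightarrow> (int \<Rightarrow> int) \<Rightarrow> real" where
  "seed_re L l \<sigma> = (\<Prod>j\<in>{1 .. int L}. amp l (\<sigma> (- int L + 2*j - 1)) (\<sigma> (- int L + 2*j)))"

definition spin_set :: "'a set \<Rightarrow> ('a \<Rightarrow> int) set" where
  "spin_set A = {\<tau>. (\<forall>p\<in>A. \<tau> p \<in> {-1, 1}) \<and> (\<forall>p. p \<notin> A \<longrightarrow> \<tau> p = 0)}"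

lemma finite_spin_set: "finite A \<Longrightarrow> finite (spin_set A)"
  unfolding spin_set_def using finite_set_of_finite_funs[of A "{-1, 1::int}" 0]
  by (simp add: all_conj_distrib Ball_def)

lemma confs_eq: "confs L = spin_set (sites L)"
  by (simp add: confs_def spin_set_def)

lemma finite_confs [simp]: "finite (confs L)"
  by (simp add: confs_eq finite_spin_set sites_def)

lemma confs_val: "\<sigma> \<in> confs L \<Longrightarrow> v \<in> sites L \<Longrightarrow> \<sigma> v = 1 \<or> \<sigma> v = - 1"
  by (auto simp: confs_def)

lemma edges_sites: "u \<in> edges L \<Longrightarrow> u \<in> sites L \<and> u + 1 \<in> sites L"
  by (auto simp: edges_def sites_def)

lemma seed_eq:
  assumes "\<sigma> \<in> confs L"
  shows "seed L l \<sigma> = complex_of_real (seed_re L l \<sigma>)"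
proof -
  have "pair_amp l (\<sigma> (- int L + 2*j - 1)) (\<sigma> (- int L + 2*j)) =
     complex_of_real (amp l (\<sigma> (- int L + 2*j - 1)) (\<sigma> (- int L + 2*j)))" if "j \<in> {1..int L}" for j
  proof -
    have "- int L + 2*j - 1 \<in> sites L" "- int L + 2*j \<in> sites L"
      using that by (auto simp: sites_def)
    then show ?thesis using confs_val[OF assms] by (fastforce simp: pair_amp_def amp_def)
  qed
  then show ?thesis by (simp add: seed_def seed_re_def)
qed

text \<open>Only one intermediate configuration survives between operators on distinct sites:
  \<open>y\<close> at \<open>v\<close> and \<open>x\<close> elsewhere.\<close>

lemma site_op_pair:
  assumes x: "x \<in> confs L" and y: "y \<in> confs L"
  shows "xxz_mult L (site_op a v) (site_op b (v + 1)) x y =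
    (if bond v x y then pauli a (x v) (y v) * pauli b (x (v + 1)) (y (v + 1)) else 0)"
proof -
  let ?z = "x(v := y v)"
  have z: "?z \<in> confs L" using x y by (auto simp: confs_def)
  have "xxz_mult L (site_op a v) (site_op b (v + 1)) x y =
    (\<Sum>z\<in>confs L. if z = ?z then (if bond v x y then pauli a (x v) (y v) * pauli b (x (v + 1)) (y (v + 1)) else 0) else 0)"
    unfolding xxz_mult_def
  proof (rule sum.cong[OF refl])
    fix z assume "z \<in> confs L"
    show "site_op a v x z * site_op b (v + 1) z y =
      (if z = ?z then (if bond v x y then pauli a (x v) (y v) * pauli b (x (v + 1)) (y (v + 1)) else 0) else 0)"
    proof (cases "z = ?z")
      case True
      then show ?thesis by (auto simp: site_op_def bond_def)
    next
      case False
      have "z = ?z" if h: "\<forall>u. u \<noteq> v \<longrightarrow> x u = z u" "\<forall>u. u \<noteq> v + 1 \<longrightarrow> z u = y u"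
      proof
        fix w show "z w = ?z w" using h by (cases "w = v") auto
      qed
      then show ?thesis using False by (auto simp: site_op_def)
    qed
  qed
  then show ?thesis using z by simp
qed

lemma bond_conf_eq:
  "x = y \<longleftrightarrow> bond u x y \<and> x u = y u \<and> x (u + 1) = y (u + 1)"
  by (auto simp: bond_def fun_eq_iff)

text \<open>A comparison of two 4 by 4 matrices, with l = s lam. On parallel spins the flips by
  tau^x and tau^y cancel and the diagonal vanishes. Antiparallel spins are exchanged with amplitude
  -1 = -exp(-l/2) exp(l/2), and on the diagonal cosh and the field combine to -exp(-l) at (+,-) and
  -exp(l) at (-,+).\<close>

lemma bond_term:
  assumes x: "x \<in> confs L" and y: "y \<in> confs L" and u: "u \<in> edges L" and s: "s = 1 \<or> s = - 1"
  shows "- (1/2) * (xxz_mult L (site_op PX u) (site_op PX (u+1)) x y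
    + xxz_mult L (site_op PY u) (site_op PY (u+1)) x y
    - complex_of_real (cosh lam) * (xxz_mult L (site_op PZ u) (site_op PZ (u+1)) x y - xxz_delta x y))
    + complex_of_real (s * sinh lam) * (site_op PZ u x y - site_op PZ (u + 1) x y) / 2
    = - complex_of_real (tl_gen (s * lam) u x y)"
proof (cases "bond u x y")
  case False
  then have "x \<noteq> y" "site_op PZ u x y = 0" "site_op PZ (u + 1) x y = 0"
    by (auto simp: bond_def site_op_def)
  then show ?thesis using False by (simp add: site_op_pair[OF x y] tl_gen_def xxz_delta_def)
next
  case True
  have Z: "site_op PZ v x y = (if x = y then of_int (x v) else 0)" for v
    by (auto simp: site_op_def fun_eq_iff)
  have eq: "x = y \<longleftrightarrow> x u = y u \<and> x (u + 1) = y (u + 1)" using True bond_conf_eq by blast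
  have sites: "u \<in> sites L" "u + 1 \<in> sites L" using edges_sites[OF u] by auto
  have e: "cosh lam + sinh lam = exp lam" "cosh lam - sinh lam = exp (- lam)"
    by (simp_all add: cosh_def sinh_def field_simps)
  define X where "X = - (1/2) * (xxz_mult L (site_op PX u) (site_op PX (u+1)) x y
    + xxz_mult L (site_op PY u) (site_op PY (u+1)) x y
    - complex_of_real (cosh lam) * (xxz_mult L (site_op PZ u) (site_op PZ (u+1)) x y - xxz_delta x y))
    + complex_of_real (s * sinh lam) * (site_op PZ u x y - site_op PZ (u + 1) x y) / 2"
  have "X = - complex_of_real (tl_gen (s * lam) u x y)"
    if "x u = a" "x (u + 1) = b" "y u = c" "y (u + 1) = d"
      and v: "a = 1 \<or> a = - 1" "b = 1 \<or> b = - 1" "c = 1 \<or> c = - 1" "d = 1 \<or> d = - 1" for a b c d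
  proof -
    have amp: "tl_gen (s * lam) u x y = amp (s * lam) a b * amp (s * lam) c d"
      using True that by (simp add: tl_gen_def)
    have X: "X = - (1/2) * (pauli PX a c * pauli PX b d + pauli PY a c * pauli PY b d
       - complex_of_real (cosh lam) * (pauli PZ a c * pauli PZ b d - (if a = c \<and> b = d then 1 else 0)))
       + complex_of_real (s * sinh lam) * (if a = c \<and> b = d then of_int a - of_int b else 0) / 2"
      using True that eq by (simp add: X_def site_op_pair[OF x y] xxz_delta_def Z)
    consider "a = 1" "b = -1" "c = 1" "d = -1" | "a = -1" "b = 1" "c = -1" "d = 1"
      | "a = 1" "b = -1" "c = -1" "d = 1" | "a = -1" "b = 1" "c = 1" "d = -1"
      | "a = b" | "c = d" using v by auto
    then show ?thesis
    proof cases
      case 1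
      have "amp (s * lam) a b * amp (s * lam) c d = exp (- s * lam)"
        using 1 by (simp add: amp_def flip: exp_add)
      moreover have "X = - complex_of_real (cosh lam - s * sinh lam)"
        unfolding X using 1 by (simp add: algebra_simps)
      moreover have "cosh lam - s * sinh lam = exp (- s * lam)" using s e by auto
      ultimately show ?thesis by (simp only: amp)
    next
      case 2
      have "amp (s * lam) a b * amp (s * lam) c d = exp (s * lam)"
        using 2 by (simp add: amp_def flip: exp_add)
      moreover have "X = - complex_of_real (cosh lam + s * sinh lam)"
        unfolding X using 2 by (simp add: algebra_simps)
      moreover have "cosh lam + s * sinh lam = exp (s * lam)" using s e by auto
      ultimately show ?thesis by (simp only: amp)
    next
      case 3
      then show ?thesis unfolding X amp by (simp add: amp_def flip: exp_add of_real_mult)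
    next
      case 4
      then show ?thesis unfolding X amp by (simp add: amp_def flip: exp_add of_real_mult)
    next
      case 5
      then show ?thesis unfolding X amp using v by (auto simp: amp_def)
    next
      case 6
      then show ?thesis unfolding X amp using v by (auto simp: amp_def)
    qed
  qed
  then show ?thesis
    using confs_val[OF x sites(1)] confs_val[OF x sites(2)] confs_val[OF y sites(1)] confs_val[OF y sites(2)]
    unfolding X_def by blast
qed

lemma sum_telescope_int:
  fixes g :: "int \<Rightarrow> 'a::ab_group_add"
  assumes "a \<le> b + 1"
  shows "(\<Sum>u\<in>{a..b}. g u - g (u + 1)) = g a - g (b + 1)"
proof -
  have "(\<Sum>u\<in>{a..a + int n - 1}. g u - g (u + 1)) = g a - g (a + int n)" for n
  proof (induction n)
    case (Suc n)
    have "{a..a + int (Suc n) - 1} = insert (a + int n) {a..a + int n - 1}" by auto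
    then show ?case using Suc by (simp add: algebra_simps)
  qed simp
  from this[of "nat (b + 1 - a)"] assms show ?thesis by simp
qed

lemma H_entry:
  assumes x: "x \<in> confs L" and y: "y \<in> confs L" and s: "s = 1 \<or> s = - 1" and L: "even L"
  shows "H_XXZ_pm L lam s x y = - complex_of_real (\<Sum>u\<in>edges L. tl_gen (s * lam) u x y)"
proof -
  have "(\<Sum>u\<in>edges L. site_op PZ u x y - site_op PZ (u + 1) x y) =
      site_op PZ (- int L + 1) x y - site_op PZ (int L) x y"
  \<comment> \<open>Without sites the telescoping range is not admissible; both boundary terms
    vanish there, because configurations are 0 off the sites and
    \<open>pauli PZ 0 0 = 0\<close>.\<close>
  proof (cases "L = 0")
    case True
    then show ?thesis using x y
      by (auto simp: edges_def site_op_def confs_def sites_def)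
  next
    case False
    then show ?thesis using sum_telescope_int[of "- int L + 1" "int L - 1" "\<lambda>u. site_op PZ u x y"]
      by (simp add: edges_def)
  qed
  then have "H_XXZ_pm L lam s x y = (\<Sum>u\<in>edges L. - (1/2) * (xxz_mult L (site_op PX u) (site_op PX (u+1)) x y
    + xxz_mult L (site_op PY u) (site_op PY (u+1)) x y
    - complex_of_real (cosh lam) * (xxz_mult L (site_op PZ u) (site_op PZ (u+1)) x y - xxz_delta x y))
    + complex_of_real (s * sinh lam) * (site_op PZ u x y - site_op PZ (u + 1) x y) / 2)"
    using L by (simp only: H_XXZ_pm_def H_XXZ_def sum.distrib edges_def[symmetric] even_power minus_one_power_iff if_True
        mult_1_right flip: sum_distrib_left sum_divide_distrib)
  also have "\<dots> = (\<Sum>u\<in>edges L. - complex_of_real (tl_gen (s * lam) u x y))"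
    by (rule sum.cong[OF refl]) (rule bond_term[OF x y _ s])
  finally show ?thesis by (simp add: sum_negf)
qed

section \<open>Powers and exponentials of the sum of bond operators\<close>

lemma tl_sum_eq: "tl_sum L l \<phi> x = (\<Sum>y\<in>confs L. (\<Sum>u\<in>edges L. tl_gen l u x y) * \<phi> y)"
  unfolding tl_sum_def tl_act_def sum_distrib_right by (rule sum.swap)

lemma tl_pow_scale: "(tl_sum L l ^^ n) (\<lambda>z. b * \<phi> z) = (\<lambda>z. b * (tl_sum L l ^^ n) \<phi> z)"
proof (induction n)
  case (Suc n)
  have "tl_sum L l (\<lambda>z. b * \<psi> z) = (\<lambda>z. b * tl_sum L l \<psi> z)" for \<psi>
    by (rule ext) (simp add: tl_sum_eq sum_distrib_left mult.left_commute)
  then show ?case using Suc by simp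
qed simp

text \<open>Linearity in the basis of configurations. This is how sums and the diagonal factor
  \<open>f\<close> are later moved past a power of the bond operators.\<close>

lemma tl_pow_expand:
  assumes "x \<in> confs L"
  shows "(tl_sum L l ^^ n) \<phi> x = (\<Sum>z\<in>confs L. \<phi> z * (tl_sum L l ^^ n) (\<lambda>y. if y = z then 1 else 0) x)"
  using assms
proof (induction n arbitrary: x)
  case (Suc n)
  let ?t = "\<lambda>x y. \<Sum>u\<in>edges L. tl_gen l u x y"
  have "(tl_sum L l ^^ Suc n) \<phi> x = (\<Sum>y\<in>confs L. ?t x y *
      (\<Sum>z\<in>confs L. \<phi> z * (tl_sum L l ^^ n) (\<lambda>y. if y = z then 1 else 0) y))"
    by (simp add: tl_sum_eq[of _ _ "(tl_sum L l ^^ n) \<phi>"] Suc.IH cong: sum.cong)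
  also have "\<dots> = (\<Sum>z\<in>confs L. \<phi> z * (\<Sum>y\<in>confs L. ?t x y * (tl_sum L l ^^ n) (\<lambda>y. if y = z then 1 else 0) y))"
    unfolding sum_distrib_left by (subst sum.swap) (simp add: mult_ac)
  moreover have "tl_sum L l \<psi> x = (\<Sum>y\<in>confs L. ?t x y * \<psi> y)" for \<psi>
    by (rule tl_sum_eq)
  ultimately show ?case by (simp only: funpow.simps(2) o_apply)
qed (simp add: if_distrib[of "(*) _"] eq_commute cong: if_cong)

text \<open>The matrix element <seed| T^m f T^k |seed>, where T is the sum of all bond operators:
  \<open>k\<close> rungs below time 0 and \<open>m\<close> above. The quantum and the Poisson side
  are both expanded in these numbers.\<close>

definition tl_elem :: "nat \<Rightarrow> real \<Rightarrow> ((int \<Rightarrow> int) \<Rightarrow> real) \<Rightarrow> nat \<Rightarrow> nat \<Rightarrow> real" where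
  "tl_elem L l f m k = (\<Sum>x\<in>confs L. seed_re L l x *
     (tl_sum L l ^^ m) (\<lambda>z. f z * (tl_sum L l ^^ k) (seed_re L l) z) x)"

lemma tl_elem_one: "tl_elem L l (\<lambda>_. 1) m k = tl_elem L l (\<lambda>_. 1) (m + k) 0"
  by (simp add: tl_elem_def funpow_add o_def eta_contract_eq)

text \<open>The exponential occurs with \<open>b = \<beta> / 2\<close> on either side of the
  observable and with \<open>b = \<beta>\<close> in the normalization; both are instances.\<close>

locale real_op =
  fixes L :: nat and A :: op and b l :: real
  assumes entry: "x \<in> confs L \<Longrightarrow> y \<in> confs L \<Longrightarrow>
      A x y = complex_of_real (b * (\<Sum>u\<in>edges L. tl_gen l u x y))"
begin

text \<open>\<open>xxz_pow\<close> grows on the right, so the induction absorbs the last factor into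
  the vector; hence \<open>\<phi>\<close> is arbitrary.\<close>

lemma pow_apply:
  "x \<in> confs L \<Longrightarrow> (\<Sum>y\<in>confs L. xxz_pow L A n x y * complex_of_real (\<phi> y))
     = complex_of_real (b ^ n * (tl_sum L l ^^ n) \<phi> x)"
proof (induction n arbitrary: \<phi>)
  case 0
  then show ?case by (simp add: xxz_delta_def if_distrib[of "\<lambda>x. x * _"] cong: if_cong)
next
  case (Suc n)
  have "(\<Sum>y\<in>confs L. xxz_pow L A (Suc n) x y * complex_of_real (\<phi> y))
    = (\<Sum>z\<in>confs L. xxz_pow L A n x z * (\<Sum>y\<in>confs L. A z y * complex_of_real (\<phi> y)))"
    unfolding xxz_pow.simps xxz_mult_def sum_distrib_left sum_distrib_right
    by (subst sum.swap) (simp add: mult_ac)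
  also have "\<dots> = (\<Sum>z\<in>confs L. xxz_pow L A n x z * complex_of_real (b * tl_sum L l \<phi> z))"
    by (intro sum.cong refl) (simp add: entry tl_sum_eq sum_distrib_left mult_ac)
  also have "\<dots> = complex_of_real (b ^ Suc n * (tl_sum L l ^^ Suc n) \<phi> x)"
    using Suc.IH[OF Suc.prems, of "\<lambda>z. b * tl_sum L l \<phi> z"]
    by (simp add: tl_pow_scale funpow_swap1 mult_ac)
  finally show ?case .
qed

lemma exp_summable:
  assumes "x \<in> confs L" "y \<in> confs L"
  shows "summable (\<lambda>n. norm (xxz_pow L A n x y / of_nat (fact n)))"
proof -
  \<comment> \<open>A crude bound: the sum of the norms of all entries dominates every column sum,
    so the entries of the \<open>n\<close>-th power are at most \<open>M ^ n\<close>.\<close>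
  define M where "M = (\<Sum>x\<in>confs L. \<Sum>y\<in>confs L. norm (A x y))"
  have M0: "M \<ge> 0" by (auto simp: M_def intro!: sum_nonneg)
  have col: "(\<Sum>z\<in>confs L. norm (A z y)) \<le> M" if "y \<in> confs L" for y
    unfolding M_def using that by (intro sum_mono member_le_sum) auto
  have bound: "norm (xxz_pow L A n x y) \<le> M ^ n" if "y \<in> confs L" for n y
    using that
  proof (induction n arbitrary: y)
    case (Suc n)
    have "norm (xxz_pow L A (Suc n) x y) \<le> (\<Sum>z\<in>confs L. norm (xxz_pow L A n x z) * norm (A z y))"
      by (simp add: xxz_mult_def) (rule order_trans[OF norm_sum], simp add: norm_mult)
    also have "\<dots> \<le> (\<Sum>z\<in>confs L. M ^ n * norm (A z y))"
      using Suc.IH by (intro sum_mono mult_right_mono) auto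
    also have "\<dots> \<le> M ^ n * M"
      unfolding sum_distrib_left[symmetric] using col[OF Suc.prems] M0 by (intro mult_left_mono) auto
    finally show ?case by (simp add: mult.commute)
  qed (simp add: xxz_delta_def)
  have "summable (\<lambda>n. M ^ n / fact n)"
    using summable_exp[of M] by (simp add: divide_inverse mult.commute)
  then show ?thesis
    by (rule summable_comparison_test')
       (use bound[OF assms(2)] in \<open>simp add: norm_divide divide_right_mono\<close>)
qed

definition coef :: "((int \<Rightarrow> int) \<Rightarrow> real) \<Rightarrow> (int \<Rightarrow> int) \<Rightarrow> nat \<Rightarrow> real" where
  "coef \<phi> x n = b ^ n / fact n * (tl_sum L l ^^ n) \<phi> x"

lemma coef_eq: "x \<in> confs L \<Longrightarrow>
  complex_of_real (coef \<phi> x n) = (\<Sum>y\<in>confs L. xxz_pow L A n x y / of_nat (fact n) * complex_of_real (\<phi> y))"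
  using pow_apply[of x n \<phi>]
  by (simp add: coef_def flip: sum_divide_distrib)

lemma exp_apply_sums:
  assumes "x \<in> confs L"
  shows "(\<lambda>n. complex_of_real (coef \<phi> x n)) sums (\<Sum>y\<in>confs L. xxz_exp L A x y * complex_of_real (\<phi> y))"
  unfolding coef_eq[OF assms] xxz_exp_def
  using exp_summable[OF assms]
  by (intro sums_sum sums_mult2 summable_sums) (auto intro: summable_norm_cancel)

lemma coef_abs_summable:
  assumes "x \<in> confs L"
  shows "summable (\<lambda>n. norm (complex_of_real (coef \<phi> x n)))"
proof -
  have "summable (\<lambda>n. \<Sum>y\<in>confs L. norm (xxz_pow L A n x y / of_nat (fact n)) * norm (complex_of_real (\<phi> y)))"
    using exp_summable[OF assms] by (intro summable_sum summable_mult2) auto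
  moreover have "norm (norm (complex_of_real (coef \<phi> x n)))
      \<le> (\<Sum>y\<in>confs L. norm (xxz_pow L A n x y / of_nat (fact n)) * norm (complex_of_real (\<phi> y)))" for n
    unfolding coef_eq[OF assms] real_norm_def abs_norm_cancel by (rule order_trans[OF norm_sum]) (simp only: norm_mult order_refl)
  ultimately show ?thesis
    by (rule summable_comparison_test'[where N = 0])
qed

lemma bra_exp_sums:
  "(\<lambda>n. complex_of_real (b ^ n / fact n * tl_elem L l (\<lambda>_. 1) n 0)) sums bra_op_ket L (seed L l) (xxz_exp L A)"
proof -
  have "bra_op_ket L (seed L l) (xxz_exp L A)
    = (\<Sum>x\<in>confs L. complex_of_real (seed_re L l x) *
        (\<Sum>y\<in>confs L. xxz_exp L A x y * complex_of_real (seed_re L l y)))"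
    unfolding bra_op_ket_def sum_distrib_left
    by (intro sum.cong refl) (simp add: seed_eq mult_ac)
  moreover have "complex_of_real (b ^ n / fact n * tl_elem L l (\<lambda>_. 1) n 0)
    = (\<Sum>x\<in>confs L. complex_of_real (seed_re L l x) * complex_of_real (coef (seed_re L l) x n))" for n
    by (simp add: tl_elem_def coef_def sum_distrib_left mult_ac sum_divide_distrib)
  ultimately show ?thesis
    using exp_apply_sums by (auto intro!: sums_sum sums_mult)
qed

text \<open>For each intermediate configuration \<open>z\<close> the matrix element is a product of
  two absolutely convergent series, one from below the observable and one from above; their Cauchy
  product collects the terms with \<open>n\<close> bond operators in total.\<close>

lemma bra_exp_diag_exp_sums:
  "(\<lambda>n. complex_of_real (b ^ n * (\<Sum>k\<le>n. tl_elem L l f (n - k) k / (fact k * fact (n - k)))))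
     sums bra_op_ket L (seed L l) (xxz_mult L (xxz_mult L (xxz_exp L A) (diag_op f)) (xxz_exp L A))"
proof -
  let ?E = "xxz_exp L A" and ?s = "seed_re L l"
  let ?\<delta> = "\<lambda>z y::int \<Rightarrow> int. if y = z then 1 else (0::real)"
  \<comment> \<open>The left factor <seed| exp(A) |z> comes from letting the exponential act on the
    basis vector at \<open>z\<close>, so the results on the action to the right apply.\<close>
  define left where "left z n = (\<Sum>x\<in>confs L. ?s x * coef (?\<delta> z) x n)" for z n
  have left_sums: "(\<lambda>n. complex_of_real (left z n)) sums (\<Sum>x\<in>confs L. complex_of_real (?s x) * ?E x z)"
    if "z \<in> confs L" for z
  proof -
    have "?E x z = (\<Sum>y\<in>confs L. ?E x y * complex_of_real (?\<delta> z y))" for x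
      using that by (simp add: if_distrib[of complex_of_real] if_distrib[of "(*) _"] cong: if_cong)
    then have "(\<lambda>n. complex_of_real (coef (?\<delta> z) x n)) sums ?E x z" if "x \<in> confs L" for x
      using exp_apply_sums[OF that, of "?\<delta> z"] by simp
    then show ?thesis
      unfolding left_def of_real_sum of_real_mult by (intro sums_sum sums_mult)
  qed
  have left_summable: "summable (\<lambda>n. norm (complex_of_real (left z n)))" for z
  proof -
    have "summable (\<lambda>n. \<Sum>x\<in>confs L. norm (complex_of_real (?s x)) * norm (complex_of_real (coef (?\<delta> z) x n)))"
      using coef_abs_summable by (intro summable_sum summable_mult) auto
    moreover have "norm (norm (complex_of_real (left z n))) \<le> (\<Sum>x\<in>confs L. norm (complex_of_real (?s x)) * norm (complex_of_real (coef (?\<delta> z) x n)))" for n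
      unfolding left_def of_real_sum of_real_mult real_norm_def abs_norm_cancel
      by (rule order_trans[OF norm_sum]) (simp only: norm_mult order_refl)
    ultimately show ?thesis
      by (rule summable_comparison_test'[where N = 0])
  qed
  have prod: "(\<lambda>n. \<Sum>k\<le>n. complex_of_real (coef ?s z k) * complex_of_real (left z (n - k))) sums
      ((\<Sum>y\<in>confs L. ?E z y * complex_of_real (?s y)) * (\<Sum>x\<in>confs L. complex_of_real (?s x) * ?E x z))"
    if "z \<in> confs L" for z
    using Cauchy_product_sums[OF coef_abs_summable[OF that] left_summable, of ?s z]
      sums_unique[OF exp_apply_sums[OF that, of ?s]] sums_unique[OF left_sums[OF that]] by simp
  have "bra_op_ket L (seed L l) (xxz_mult L (xxz_mult L ?E (diag_op f)) ?E)
    = (\<Sum>x\<in>confs L. \<Sum>y\<in>confs L. \<Sum>z\<in>confs L.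
        complex_of_real (f z) * ((?E z y * complex_of_real (?s y)) * (complex_of_real (?s x) * ?E x z)))"
    unfolding bra_op_ket_def
  proof (intro sum.cong refl)
    fix x y assume xy: "x \<in> confs L" "y \<in> confs L"
    have "xxz_mult L ?E (diag_op f) x z = ?E x z * complex_of_real (f z)" if "z \<in> confs L" for z
      using that by (simp add: xxz_mult_def diag_op_def if_distrib[of "(*) _"] cong: if_cong)
    then show "cnj (seed L l x) * xxz_mult L (xxz_mult L ?E (diag_op f)) ?E x y * seed L l y =
      (\<Sum>z\<in>confs L. complex_of_real (f z) * ((?E z y * complex_of_real (?s y)) * (complex_of_real (?s x) * ?E x z)))"
      unfolding xxz_mult_def[of L _ ?E] sum_distrib_left sum_distrib_right
      by (intro sum.cong refl) (simp add: seed_eq xy mult_ac)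
  qed
  also have "\<dots> = (\<Sum>z\<in>confs L. \<Sum>x\<in>confs L. \<Sum>y\<in>confs L.
        complex_of_real (f z) * ((?E z y * complex_of_real (?s y)) * (complex_of_real (?s x) * ?E x z)))"
    by (subst (2) sum.swap, subst sum.swap) (rule refl)
  also have "\<dots> = (\<Sum>z\<in>confs L. complex_of_real (f z) *
      ((\<Sum>y\<in>confs L. ?E z y * complex_of_real (?s y)) * (\<Sum>x\<in>confs L. complex_of_real (?s x) * ?E x z)))"
    by (rule sum.cong[OF refl], unfold sum_product, unfold sum_distrib_left) (rule sum.swap)
  finally have bra: "bra_op_ket L (seed L l) (xxz_mult L (xxz_mult L ?E (diag_op f)) ?E) = \<dots>" .
  have nth: "complex_of_real (b ^ n * (\<Sum>k\<le>n. tl_elem L l f (n - k) k / (fact k * fact (n - k)))) =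
     (\<Sum>z\<in>confs L. complex_of_real (f z) * (\<Sum>k\<le>n. complex_of_real (coef ?s z k) * complex_of_real (left z (n - k))))" for n
  proof -
    have e: "tl_elem L l f m k = (\<Sum>z\<in>confs L. f z * (tl_sum L l ^^ k) ?s z * (\<Sum>x\<in>confs L. ?s x * (tl_sum L l ^^ m) (?\<delta> z) x))" for m k
    proof -
      have "tl_elem L l f m k = (\<Sum>x\<in>confs L. ?s x * (\<Sum>z\<in>confs L. (f z * (tl_sum L l ^^ k) ?s z) * (tl_sum L l ^^ m) (?\<delta> z) x))"
        unfolding tl_elem_def by (intro sum.cong refl) (subst tl_pow_expand, auto)
      also have "\<dots> = (\<Sum>z\<in>confs L. \<Sum>x\<in>confs L. ?s x * ((f z * (tl_sum L l ^^ k) ?s z) * (tl_sum L l ^^ m) (?\<delta> z) x))"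
        unfolding sum_distrib_left by (rule sum.swap)
      finally show ?thesis by (simp add: sum_distrib_left mult_ac)
    qed
    have "b ^ n * (\<Sum>k\<le>n. tl_elem L l f (n - k) k / (fact k * fact (n - k)))
      = (\<Sum>k\<le>n. \<Sum>z\<in>confs L. f z * (coef ?s z k * left z (n - k)))"
      unfolding sum_distrib_left
    proof (intro sum.cong refl)
      fix k assume "k \<in> {..n}"
      then have "b ^ n = b ^ k * b ^ (n - k)" by (simp flip: power_add)
      then show "b ^ n * (tl_elem L l f (n - k) k / (fact k * fact (n - k))) = (\<Sum>z\<in>confs L. f z * (coef ?s z k * left z (n - k)))"
        unfolding e left_def coef_def
        by (simp add: sum_distrib_left sum_divide_distrib mult_ac)
    qed
    also have "\<dots> = (\<Sum>z\<in>confs L. f z * (\<Sum>k\<le>n. coef ?s z k * left z (n - k)))"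
      unfolding sum_distrib_left by (rule sum.swap)
    finally show ?thesis by simp
  qed
  show ?thesis
    unfolding bra nth using prod by (intro sums_sum sums_mult) auto
qed

end

lemma real_op_xxz:
  assumes "even L" "s = 1 \<or> s = - 1"
  shows "real_op L (scale_op (- c) (H_XXZ_pm L lam s)) c (s * lam)"
  by unfold_locales (simp add: scale_op_def H_entry assms)

section \<open>Poisson integrals of order-invariant functions\<close>

text \<open>\<open>\<phi>\<close> is increasing only on the times that occur and on 0, so that a
  rank function may serve as \<open>\<phi>\<close>. The condition compares sets of rungs and thereby
  also removes the order of the list. Time 0 is fixed because the spins are read there.\<close>

definition order_inv :: "(rung list \<Rightarrow> 'a) \<Rightarrow> bool" where
  "order_inv G \<longleftrightarrow> (\<forall>\<omega> \<omega>' \<phi>. strict_mono_on (insert 0 (snd ` set \<omega>)) \<phi> \<longrightarrow> \<phi> 0 = 0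
      \<longrightarrow> set \<omega>' = apsnd \<phi> ` set \<omega> \<longrightarrow> G \<omega>' = G \<omega>)"

lemma order_inv_set:
  assumes "order_inv G" "set \<omega>' = set \<omega>"
  shows "G \<omega>' = G \<omega>"
proof -
  have "set \<omega>' = apsnd (\<lambda>x. x) ` set \<omega>" using assms(2) by (simp add: apsnd_def map_prod_def)
  then show ?thesis
    using assms(1) unfolding order_inv_def
    by (elim allE[of _ \<omega>] allE[of _ \<omega>'] allE[of _ "\<lambda>x. x"]) (simp add: strict_mono_on_def)
qed

definition words :: "nat \<Rightarrow> nat \<Rightarrow> int list set" where
  "words L n = {es. length es = n \<and> set es \<subseteq> edges L}"

lemma finite_words [simp]: "finite (words L n)"
proof -
  have "words L n = {es. set es \<subseteq> edges L \<and> length es = n}" by (auto simp: words_def)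
  moreover have "finite (edges L)" by (simp add: edges_def)
  ultimately show ?thesis by (simp add: finite_lists_length_eq)
qed

text \<open>A strictly increasing integer-valued relabelling of the times and of 0; it shows that an
  order-invariant function is measurable. Counting both strict and weak inequalities separates
  the times from 0.\<close>

definition order_rank :: "nat \<Rightarrow> (nat \<Rightarrow> real) \<Rightarrow> real \<Rightarrow> real" where
  "order_rank n t x = (\<Sum>j<n. (if t j < x then 1 else 0) + (if t j \<le> x then 1 else 0)
      - (if t j < 0 then 1 else 0) - (if t j \<le> 0 then 1 else 0))"

lemma rank_strict_mono: "strict_mono_on (insert 0 (t ` {..<n})) (order_rank n t)"
proof (rule strict_mono_onI)
  fix x y assume x: "x \<in> insert 0 (t ` {..<n})" and y: "y \<in> insert 0 (t ` {..<n})" and "x < y"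
  let ?f = "\<lambda>x j. (if t j < x then 1 else 0) + (if t j \<le> x then 1 else 0)
      - (if t j < 0 then 1 else 0) - (if t j \<le> 0 then 1 else (0::real))"
  have le: "?f x j \<le> ?f y j" for j using \<open>x < y\<close> by auto
  \<comment> \<open>The two points cannot both be 0, so one of them is a time \<open>t j\<close>.
    Its strict count increases if it is \<open>x\<close>, its weak count if it is
    \<open>y\<close>.\<close>
  have "\<exists>j<n. t j = x \<or> t j = y" using x y \<open>x < y\<close> by auto
  then have "\<exists>j\<in>{..<n}. ?f x j < ?f y j" using \<open>x < y\<close> by force
  then show "order_rank n t x < order_rank n t y"
    unfolding order_rank_def using le by (intro sum_strict_mono_ex1) auto
qed

lemma rank_0: "order_rank n t 0 = 0"
  by (simp add: order_rank_def)

lemma rank_range: "order_rank n t x \<in> real_of_int ` {- 2 * int n..2 * int n}"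
proof -
  let ?f = "\<lambda>j. (if t j < x then 1 else 0) + (if t j \<le> x then 1 else 0)
      - (if t j < 0 then 1 else 0) - (if t j \<le> 0 then 1 else (0::int))"
  have eq: "order_rank n t x = real_of_int (\<Sum>j<n. ?f j)"
    unfolding order_rank_def of_int_sum by (intro sum.cong) auto
  have "\<bar>\<Sum>j<n. ?f j\<bar> \<le> (\<Sum>j<n. 2)"
    by (rule order_trans[OF sum_abs]) (intro sum_mono, auto)
  also have "\<dots> = 2 * int n" by simp
  finally have "\<exists>s. order_rank n t x = real_of_int s \<and> \<bar>s\<bar> \<le> 2 * int n"
    by (rule exI[where P = "\<lambda>s. order_rank n t x = real_of_int s \<and> \<bar>s\<bar> \<le> 2 * int n", OF conjI[OF eq]])
  then show ?thesis by (auto intro!: imageI simp: abs_le_iff)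
qed

lemma order_inv_rank:
  assumes "order_inv G" "length es = n"
  shows "G (zip es (map t [0..<n])) = G (zip es (map (\<lambda>i. order_rank n t (t i)) [0..<n]))"
proof -
  have z: "set (zip es (map s [0..<n])) = (\<lambda>i. (es ! i, s i)) ` {..<n}" for s :: "nat \<Rightarrow> real"
    using assms(2) by (auto simp: set_zip)
  have "snd ` set (zip es (map t [0..<n])) = t ` {..<n}" unfolding z by force
  moreover have "set (zip es (map (\<lambda>i. order_rank n t (t i)) [0..<n])) = apsnd (order_rank n t) ` set (zip es (map t [0..<n]))"
    unfolding z by force
  ultimately show ?thesis
    using assms(1) rank_strict_mono[of t n] rank_0[of n t] unfolding order_inv_def by metis
qed

lemma permute_words:
  assumes "mset p = mset [0..<n]"
  shows "bij_betw (\<lambda>es. map ((!) es) p) (words L n) (words L n)"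
proof -
  have len: "length p = n" using assms by (metis length_upt mset_eq_length diff_zero)
  have set: "set p = {..<n}" using assms by (metis mset_eq_setD set_upt atLeast0LessThan)
  have "inj_on (\<lambda>es. map ((!) es) p) (words L n)"
  proof (rule inj_onI)
    fix es es' assume *: "es \<in> words L n" "es' \<in> words L n" "map ((!) es) p = map ((!) es') p"
    then have "es ! i = es' ! i" if "i < n" for i using that set by (auto simp: map_eq_conv)
    then show "es = es'" using * by (intro nth_equalityI) (auto simp: words_def)
  qed
  moreover have "(\<lambda>es. map ((!) es) p) ` words L n \<subseteq> words L n"
    using len set by (fastforce simp: words_def)
  ultimately show ?thesis by (simp add: bij_betw_def endo_inj_surj)
qed

lemma sum_words_append:
  assumes "n = a + b"
  shows "(\<Sum>es\<in>words L n. g (take a es) (drop a es)) = (\<Sum>r\<in>words L a. \<Sum>q\<in>words L b. g r q)"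
proof -
  have "(\<Sum>es\<in>words L n. g (take a es) (drop a es)) = (\<Sum>(r, q)\<in>words L a \<times> words L b. g r q)"
    by (rule sum.reindex_bij_witness[of _ "\<lambda>(r, q). r @ q" "\<lambda>es. (take a es, drop a es)"])
       (use assms set_take_subset set_drop_subset in \<open>force simp: words_def\<close>)+
  then show ?thesis by (simp add: sum.cartesian_product)
qed

lemma sorted_desc_split:
  fixes ts :: "real list"
  assumes "sorted_wrt (>) ts" "0 \<notin> set ts"
  shows "ts = filter (\<lambda>x. x > 0) ts @ filter (\<lambda>x. x < 0) ts"
  using assms
proof (induction ts)
  case (Cons x ts)
  show ?case
  proof (cases "x > 0")
    case True
    then show ?thesis using Cons by auto
  next
    case False
    then have "filter (\<lambda>x. x > 0) ts = []" using Cons.prems by (auto simp: filter_empty_conv)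
    then show ?thesis using Cons False by auto
  qed
qed simp

text \<open>Sorting the times permutes the edge labels, and the sum runs over all labellings; this is why
  no volume of a time-ordered simplex has to be computed.\<close>

lemma sum_generic:
  fixes t :: "nat \<Rightarrow> real" and G :: "rung list \<Rightarrow> real"
  assumes G: "order_inv G"
    and Z: "\<And>r q ts us. set r \<subseteq> edges L \<Longrightarrow> set q \<subseteq> edges L \<Longrightarrow> length r = length ts \<Longrightarrow> length q = length us
       \<Longrightarrow> sorted_wrt (>) (ts @ us) \<Longrightarrow> (\<forall>x\<in>set ts. x > 0) \<Longrightarrow> (\<forall>x\<in>set us. x < 0)
       \<Longrightarrow> G (zip (r @ q) (ts @ us)) = Z r q"
    and inj: "inj_on t {..<n}" and nz: "\<And>i. i < n \<Longrightarrow> t i \<noteq> 0"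
    and k: "k = card {i\<in>{..<n}. t i < 0}"
  shows "(\<Sum>es\<in>words L n. G (zip es (map t [0..<n]))) = (\<Sum>r\<in>words L (n - k). \<Sum>q\<in>words L k. Z r q)"
proof -
  \<comment> \<open>Decreasing times, in accordance with the convention that the head of a word is
    the latest rung.\<close>
  define p where "p = rev (sort_key t [0..<n])"
  have mp: "mset p = mset [0..<n]" by (simp add: p_def)
  have len: "length p = n" by (simp add: p_def)
  have set: "set p = {..<n}" by (auto simp: p_def)
  have dist: "distinct p" by (simp add: p_def)
  define ts where "ts = filter (\<lambda>x. x > 0) (map t p)"
  define us where "us = filter (\<lambda>x. x < 0) (map t p)"
  have "sorted (rev (map t p))" by (simp add: p_def rev_map)
  moreover have "distinct (map t p)" using dist inj set by (simp add: distinct_map)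
  ultimately have sd: "sorted_wrt (>) (map t p)"
    by (metis (no_types, lifting) distinct_rev rev_rev_ident sorted_wrt_rev strict_sorted_iff greaterThan_def sorted_wrt_mono_rel)
  have split: "map t p = ts @ us"
    unfolding ts_def us_def by (rule sorted_desc_split[OF sd]) (use nz set in auto)
  have "length us = length (filter (\<lambda>i. t i < 0) p)" by (simp add: us_def filter_map o_def)
  also have "\<dots> = card (set (filter (\<lambda>i. t i < 0) p))"
    by (rule distinct_card[symmetric]) (simp add: dist)
  also have "\<dots> = k" by (simp add: k set)
  finally have lus: "length us = k" .
  then have lts: "length ts = n - k" "k \<le> n" using arg_cong[OF split, of length] len by auto
  have perm: "G (zip es (map t [0..<n])) = G (zip (map ((!) es) p) (map t p))" if "es \<in> words L n" for es
  proof (rule order_inv_set[OF G])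
    have "length es = n" using that by (simp add: words_def)
    then have "set (zip es (map t [0..<n])) = (\<lambda>i. (es ! i, t i)) ` {..<n}"
      by (auto simp: set_zip)
    moreover have "zip (map ((!) es) p) (map t p) = map (\<lambda>i. (es ! i, t i)) p"
      by (simp add: zip_map_map zip_same_conv_map)
    ultimately show "set (zip es (map t [0..<n])) = set (zip (map ((!) es) p) (map t p))"
      by (simp add: set)
  qed
  have "(\<Sum>es\<in>words L n. G (zip es (map t [0..<n]))) = (\<Sum>es\<in>words L n. G (zip (map ((!) es) p) (map t p)))"
    by (rule sum.cong[OF refl]) (rule perm)
  also have "\<dots> = (\<Sum>es\<in>words L n. G (zip es (map t p)))"
    by (rule sum.reindex_bij_betw[OF permute_words[OF mp]])
  also have "\<dots> = (\<Sum>es\<in>words L n. Z (take (n - k) es) (drop (n - k) es))"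
  proof (rule sum.cong[OF refl])
    fix es assume es: "es \<in> words L n"
    have "G (zip (take (n - k) es @ drop (n - k) es) (ts @ us)) = Z (take (n - k) es) (drop (n - k) es)"
    proof (rule Z)
      show "set (take (n - k) es) \<subseteq> edges L" "set (drop (n - k) es) \<subseteq> edges L"
        using es set_take_subset set_drop_subset unfolding words_def by fastforce+
      show "sorted_wrt (>) (ts @ us)" using sd split by simp
    qed (use es lts lus in \<open>auto simp: words_def ts_def us_def\<close>)
    then show "G (zip es (map t p)) = Z (take (n - k) es) (drop (n - k) es)" by (simp add: split)
  qed
  also have "\<dots> = (\<Sum>r\<in>words L (n - k). \<Sum>q\<in>words L k. Z r q)"
    by (rule sum_words_append) (use lts in simp)
  finally show ?thesis .
qed

lemma sum_Pow_card:
  fixes g :: "nat \<Rightarrow> real"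
  assumes "finite A"
  shows "(\<Sum>J\<in>Pow A. g (card J)) = (\<Sum>k\<le>card A. real (card A choose k) * g k)"
proof -
  have "(\<Sum>J\<in>Pow A. g (card J)) = (\<Sum>k\<le>card A. \<Sum>J\<in>{J\<in>Pow A. card J = k}. g (card J))"
    by (rule sum.group[symmetric]) (use assms card_mono in auto)
  also have "\<dots> = (\<Sum>k\<le>card A. \<Sum>J\<in>{J. J \<subseteq> A \<and> card J = k}. g k)"
    by (intro sum.cong) auto
  finally show ?thesis using assms by (simp add: n_subsets)
qed

section \<open>Integration over independent uniform rung times\<close>

abbreviation time_measure :: "real \<Rightarrow> real measure" where
  "time_measure \<beta> \<equiv> restrict_space lborel {- \<beta> / 2 <..< \<beta> / 2}"

context
  fixes \<beta> :: real
  assumes \<beta>: "\<beta> > 0"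
begin

lemma finite_time: "finite_measure (time_measure \<beta>)"
  using \<beta> by (intro finite_measureI) (simp add: space_restrict_space emeasure_restrict_space)

interpretation T: finite_measure "time_measure \<beta>" by (rule finite_time)
interpretation P: product_sigma_finite "\<lambda>_::nat. time_measure \<beta>" by unfold_locales

lemma id_measurable_time [measurable]: "(\<lambda>x. x) \<in> borel_measurable (time_measure \<beta>)"
  by (rule measurable_restrict_space1) simp

lemma component_measurable_time [measurable]:
  "i \<in> I \<Longrightarrow> (\<lambda>t. t i) \<in> borel_measurable (PiM I (\<lambda>_::nat. time_measure \<beta>))"
proof -
  assume "i \<in> I"
  then have "(\<lambda>t. t i) \<in> measurable (PiM I (\<lambda>_::nat. time_measure \<beta>)) (time_measure \<beta>)"
    by (rule measurable_component_singleton)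
  from measurable_compose[OF this id_measurable_time] show ?thesis .
qed

lemma finite_PiM_time: "finite I \<Longrightarrow> finite_measure (PiM I (\<lambda>_::nat. time_measure \<beta>))"
proof (rule finite_measureI)
  assume I: "finite I"
  have "emeasure (time_measure \<beta>) (space (time_measure \<beta>)) ^ card I \<noteq> top"
    by (subst T.emeasure_eq_measure, subst ennreal_power[OF measure_nonneg]) (rule ennreal_neq_top)
  then show "emeasure (PiM I (\<lambda>_::nat. time_measure \<beta>)) (space (PiM I (\<lambda>_::nat. time_measure \<beta>))) \<noteq> \<infinity>"
    by (subst space_PiM, subst P.emeasure_PiM[OF I]) (rule sets.top, simp only: prod_constant infinity_ennreal_def not_False_eq_True)
qed

text \<open>Fubini in the coordinate \<open>i\<close>: as \<open>h\<close> ignores this coordinate,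
  the exceptional set for fixed other times is at most one point. Taking another coordinate or 0 for
  \<open>h\<close> gives general position of the times.\<close>

lemma AE_time_neq:
  assumes I: "finite I" "i \<in> I"
    and h: "h \<in> borel_measurable (PiM I (\<lambda>_::nat. time_measure \<beta>))"
    and h': "\<And>t x. h (t(i := x)) = h t"
  shows "AE t in PiM I (\<lambda>_::nat. time_measure \<beta>). t i \<noteq> h t"
proof -
  let ?M = "PiM I (\<lambda>_::nat. time_measure \<beta>)" and ?J = "I - {i}"
  have IJ: "I = insert i ?J" using I by auto
  have [measurable]: "(\<lambda>t. t i) \<in> borel_measurable ?M" using I by measurable
  note h [measurable]
  have f: "(\<lambda>t. indicator {t\<in>space ?M. t i = h t} t :: ennreal) \<in> borel_measurable ?M"
    by measurable
  have "emeasure ?M {t\<in>space ?M. t i = h t} = (\<integral>\<^sup>+t. indicator {t\<in>space ?M. t i = h t} t \<partial>?M)"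
    by (rule nn_integral_indicator[symmetric]) measurable
  also have "\<dots> = (\<integral>\<^sup>+t. (\<integral>\<^sup>+x. indicator {t\<in>space ?M. t i = h t} (t(i := x)) \<partial>time_measure \<beta>) \<partial>PiM ?J (\<lambda>_. time_measure \<beta>))"
    using P.product_nn_integral_insert[of ?J i "indicator {t\<in>space ?M. t i = h t}"] f I
    by (simp add: IJ[symmetric] insert_absorb)
  also have "\<dots> = (\<integral>\<^sup>+t. 0 \<partial>PiM ?J (\<lambda>_. time_measure \<beta>))"
  proof (rule nn_integral_cong)
    fix t
    have "(\<integral>\<^sup>+x. indicator {t\<in>space ?M. t i = h t} (t(i := x)) \<partial>time_measure \<beta>) \<le>
        (\<integral>\<^sup>+x. indicator {h t} x \<partial>time_measure \<beta>)"
      by (rule nn_integral_mono) (auto simp: h' indicator_def)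
    also have "\<dots> = (\<integral>\<^sup>+x. indicator {h t} x * indicator {- \<beta> / 2 <..< \<beta> / 2} x \<partial>lborel)"
      by (rule nn_integral_restrict_space) simp
    also have "\<dots> = (\<integral>\<^sup>+(x::real). 0 \<partial>lborel)"
      by (rule nn_integral_cong_AE, rule eventually_mono[OF AE_lborel_singleton[of "h t"]]) simp
    also have "\<dots> = 0" by simp
    finally show "(\<integral>\<^sup>+x. indicator {t\<in>space ?M. t i = h t} (t(i := x)) \<partial>time_measure \<beta>) = 0"
      by (simp only: le_zero_eq)
  qed
  finally have z: "emeasure ?M {t\<in>space ?M. t i = h t} = 0" by simp
  have "{t\<in>space ?M. t i = h t} \<in> sets ?M" by measurable
  then show ?thesis by (rule AE_I[OF _ z, rotated]) blast
qed

lemma AE_time_generic: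
  "AE t in PiM {..<n} (\<lambda>_::nat. time_measure \<beta>). inj_on t {..<n} \<and> (\<forall>i<n. t i \<noteq> 0)"
proof -
  let ?M = "PiM {..<n} (\<lambda>_::nat. time_measure \<beta>)"
  have "AE t in ?M. \<forall>i\<in>{..<n}. \<forall>j\<in>{..<n}. i \<noteq> j \<longrightarrow> t i \<noteq> t j"
  proof (intro AE_finite_allI finite_lessThan)
    fix i j assume ij: "i \<in> {..<n}" "j \<in> {..<n}"
    show "AE t in ?M. i \<noteq> j \<longrightarrow> t i \<noteq> t j"
    proof (cases "i = j")
      case False
      have "AE t in ?M. t i \<noteq> t j"
        by (rule AE_time_neq, simp, rule ij, rule component_measurable_time, rule ij) (use False in simp)
      then show ?thesis by eventually_elim simp
    qed simp
  qed
  moreover have "AE t in ?M. \<forall>i\<in>{..<n}. t i \<noteq> 0"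
    by (intro AE_finite_allI finite_lessThan AE_time_neq) auto
  ultimately show ?thesis by eventually_elim (auto simp: inj_on_def)
qed

text \<open>The function depends on the times only through their vector of ranks, which is
  measurable and takes finitely many values.\<close>

lemma order_inv_integrable:
  fixes G :: "rung list \<Rightarrow> real"
  assumes G: "order_inv G" and es: "length es = n"
  shows "integrable (PiM {..<n} (\<lambda>_. time_measure \<beta>)) (\<lambda>t. G (zip es (map t [0..<n])))"
proof -
  let ?M = "PiM {..<n} (\<lambda>_::nat. time_measure \<beta>)"
  interpret M: finite_measure ?M by (rule finite_PiM_time) simp
  define R where "R = PiE {..<n} (\<lambda>_. real_of_int ` {- 2 * int n..2 * int n})"
  define F where "F t = (\<lambda>i\<in>{..<n}. order_rank n t (t i))" for t
  have finR: "finite R" unfolding R_def by (intro finite_PiE) auto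
  have FR: "F t \<in> R" for t unfolding R_def F_def using rank_range by auto
  have rm: "(\<lambda>t. order_rank n t (t i)) \<in> borel_measurable ?M" if "i < n" for i
  proof -
    have m: "(\<lambda>t. t j) \<in> borel_measurable ?M" if "j < n" for j
      using that by (intro component_measurable_time) auto
    show ?thesis unfolding order_rank_def
    proof (rule borel_measurable_sum)
      fix j assume "j \<in> {..<n}"
      then have [measurable]: "(\<lambda>t. t j) \<in> borel_measurable ?M" "(\<lambda>t. t i) \<in> borel_measurable ?M"
        using m that by auto
      show "(\<lambda>t. (if t j < t i then 1 else 0) + (if t j \<le> t i then 1 else 0)
          - (if t j < 0 then 1 else 0) - (if t j \<le> 0 then 1 else (0::real))) \<in> borel_measurable ?M"
        by measurable
    qed
  qed
  have "F \<in> measurable ?M (count_space R)"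
  proof (subst measurable_count_space_eq2[OF finR], intro conjI ballI)
    fix a assume "a \<in> R"
    then have "F -` {a} \<inter> space ?M = {t\<in>space ?M. \<forall>i\<in>{..<n}. order_rank n t (t i) = a i}"
      by (auto simp: F_def R_def PiE_def extensional_def fun_eq_iff)
    also have "\<dots> \<in> sets ?M"
      using rm by (intro sets.sets_Collect_finite_All borel_measurable_eq) auto
    finally show "F -` {a} \<inter> space ?M \<in> sets ?M" .
  qed (use FR in auto)
  then have "(\<lambda>t. G (zip es (map (F t) [0..<n]))) \<in> borel_measurable ?M"
    by (rule measurable_compose) simp
  moreover have "norm (G (zip es (map (F t) [0..<n]))) \<le> (\<Sum>a\<in>R. norm (G (zip es (map a [0..<n]))))" for t
    by (rule member_le_sum[OF FR]) (use finR in auto)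
  ultimately have "integrable ?M (\<lambda>t. G (zip es (map (F t) [0..<n])))"
    by (intro M.integrable_const_bound) auto
  moreover have "map (F t) [0..<n] = map (\<lambda>i. order_rank n t (t i)) [0..<n]" for t
    by (simp add: F_def)
  ultimately show ?thesis using order_inv_rank[OF G es] by simp
qed

text \<open>Splitting by the set \<open>J\<close> of indices with negative time turns the integrand
  into a sum of products. Each factor integrates to \<beta>/2 whichever half it selects, so only the
  size of \<open>J\<close> remains.\<close>

lemma integral_negative_count:
  fixes g :: "nat \<Rightarrow> real"
  shows "integrable (PiM {..<n} (\<lambda>_. time_measure \<beta>)) (\<lambda>t. g (card {i\<in>{..<n}. t i < 0}))"
    and "integral\<^sup>L (PiM {..<n} (\<lambda>_. time_measure \<beta>)) (\<lambda>t. g (card {i\<in>{..<n}. t i < 0}))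
      = (\<Sum>k\<le>n. real (n choose k) * ((\<beta> / 2) ^ n * g k))"
proof -
  let ?M = "PiM {..<n} (\<lambda>_::nat. time_measure \<beta>)"
  \<comment> \<open>The half-lines are complementary, with 0 in the nonnegative one, so for every
    \<open>t\<close> exactly one \<open>J\<close> contributes.\<close>
  define c where "c J i x = (indicator (if i \<in> J then {..<0} else {0..}) x :: real)" for J :: "nat set" and i :: nat and x :: real
  have fact: "g (card {i\<in>{..<n}. t i < 0}) = (\<Sum>J\<in>Pow {..<n}. g (card J) * (\<Prod>i<n. c J i (t i)))" for t :: "nat \<Rightarrow> real"
  proof -
    have "(\<Prod>i<n. c J i (t i)) = (if J = {i\<in>{..<n}. t i < 0} then 1 else 0)" if "J \<in> Pow {..<n}" for J
    proof (cases "J = {i\<in>{..<n}. t i < 0}")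
      case False
      then have "\<exists>i<n. (i \<in> J) \<noteq> (t i < 0)" using that by blast
      then obtain i where "i < n" "(i \<in> J) \<noteq> (t i < 0)" by blast
      then have "c J i (t i) = 0" by (auto simp: c_def)
      then show ?thesis using False \<open>i < n\<close> by (auto intro!: prod_zero)
    qed (auto simp: c_def intro!: prod.neutral)
    then have "(\<Sum>J\<in>Pow {..<n}. g (card J) * (\<Prod>i<n. c J i (t i))) =
       (\<Sum>J\<in>Pow {..<n}. if J = {i\<in>{..<n}. t i < 0} then g (card J) else 0)"
      by (intro sum.cong) auto
    then show ?thesis by (simp add: sum.delta subset_iff)
  qed
  have ci: "integrable (time_measure \<beta>) (c J i)" for J i
    unfolding c_def by (intro T.integrable_const_bound[of _ 1] AE_I2 measurable_restrict_space1) (auto simp: indicator_def)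
  have cint: "integral\<^sup>L (time_measure \<beta>) (c J i) = \<beta> / 2" for J i
  proof -
    have "integral\<^sup>L (time_measure \<beta>) (c J i) = (\<integral>x. indicator {- \<beta> / 2 <..< \<beta> / 2} x *\<^sub>R c J i x \<partial>lborel)"
      by (rule integral_restrict_space) simp
    also have "\<dots> = (\<integral>x. indicator (if i \<in> J then {- \<beta> / 2 <..< 0} else {0..<\<beta> / 2}) x \<partial>lborel)"
      using \<beta> by (intro Bochner_Integration.integral_cong) (auto simp: c_def indicator_def)
    also have "\<dots> = \<beta> / 2" using \<beta> by simp
    finally show ?thesis .
  qed
  have pi: "integrable ?M (\<lambda>t. \<Prod>i<n. c J i (t i))" for J
    by (rule P.product_integrable_prod, simp, rule ci)
  show "integrable ?M (\<lambda>t. g (card {i\<in>{..<n}. t i < 0}))"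
    unfolding fact by (intro Bochner_Integration.integrable_sum integrable_mult_right pi)
  have "integral\<^sup>L ?M (\<lambda>t. g (card {i\<in>{..<n}. t i < 0})) = (\<Sum>J\<in>Pow {..<n}. g (card J) * integral\<^sup>L ?M (\<lambda>t. \<Prod>i<n. c J i (t i)))"
    unfolding fact using pi by (subst Bochner_Integration.integral_sum) auto
  also have "\<dots> = (\<Sum>J\<in>Pow {..<n}. g (card J) * (\<beta> / 2) ^ n)"
    by (subst P.product_integral_prod[OF _ ci]) (simp_all only: finite_lessThan cint prod_constant card_lessThan)
  also have "\<dots> = (\<Sum>k\<le>n. real (n choose k) * ((\<beta> / 2) ^ n * g k))"
    using sum_Pow_card[of "{..<n}" "\<lambda>k. g k * (\<beta> / 2) ^ n"] by (simp add: mult_ac)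
  finally show "integral\<^sup>L ?M (\<lambda>t. g (card {i\<in>{..<n}. t i < 0})) = \<dots>" .
qed

text \<open>A single integrand still depends on which edge carries which time; only the sum over all
  labellings is a function of the number of negative times. Therefore sum and integral are exchanged
  before integrating.\<close>

lemma rho_term:
  fixes G :: "rung list \<Rightarrow> real"
  assumes G: "order_inv G"
    and Z: "\<And>r q ts us. set r \<subseteq> edges L \<Longrightarrow> set q \<subseteq> edges L \<Longrightarrow> length r = length ts \<Longrightarrow> length q = length us
       \<Longrightarrow> sorted_wrt (>) (ts @ us) \<Longrightarrow> (\<forall>x\<in>set ts. x > 0) \<Longrightarrow> (\<forall>x\<in>set us. x < 0)
       \<Longrightarrow> G (zip (r @ q) (ts @ us)) = Z r q"
  shows "(\<Sum>es\<in>words L n. integral\<^sup>L (PiM {..<n} (\<lambda>_. time_measure \<beta>)) (\<lambda>t. G (zip es (map t [0..<n]))))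
    = (\<Sum>k\<le>n. real (n choose k) * ((\<beta> / 2) ^ n * (\<Sum>r\<in>words L (n - k). \<Sum>q\<in>words L k. Z r q)))"
proof -
  let ?M = "PiM {..<n} (\<lambda>_::nat. time_measure \<beta>)"
  let ?g = "\<lambda>k. \<Sum>r\<in>words L (n - k). \<Sum>q\<in>words L k. Z r q"
  have int: "integrable ?M (\<lambda>t. G (zip es (map t [0..<n])))" if "es \<in> words L n" for es
    using that by (intro order_inv_integrable[OF G]) (simp add: words_def)
  have "(\<Sum>es\<in>words L n. integral\<^sup>L ?M (\<lambda>t. G (zip es (map t [0..<n]))))
      = integral\<^sup>L ?M (\<lambda>t. \<Sum>es\<in>words L n. G (zip es (map t [0..<n])))"
    using int by (subst Bochner_Integration.integral_sum) auto
  also have "\<dots> = integral\<^sup>L ?M (\<lambda>t. ?g (card {i\<in>{..<n}. t i < 0}))"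
  proof (rule integral_cong_AE)
    show "(\<lambda>t. \<Sum>es\<in>words L n. G (zip es (map t [0..<n]))) \<in> borel_measurable ?M"
      using int by (intro borel_measurable_sum) (blast dest: borel_measurable_integrable)
    show "(\<lambda>t. ?g (card {i\<in>{..<n}. t i < 0})) \<in> borel_measurable ?M"
      by (rule borel_measurable_integrable[OF integral_negative_count(1)])
    show "AE t in ?M. (\<Sum>es\<in>words L n. G (zip es (map t [0..<n]))) = ?g (card {i\<in>{..<n}. t i < 0})"
      using AE_time_generic
    proof eventually_elim
      case (elim t)
      then show ?case by (intro sum_generic[OF G Z]) auto
    qed
  qed
  also have "\<dots> = (\<Sum>k\<le>n. real (n choose k) * ((\<beta> / 2) ^ n * ?g k))"
    by (rule integral_negative_count(2))
  finally show ?thesis .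
qed

end

section \<open>Rung configurations and words\<close>

definition rung_times :: "rung list \<Rightarrow> int \<Rightarrow> real set" where
  "rung_times \<omega> v = {t. \<exists>u. (u, t) \<in> set \<omega> \<and> (u = v \<or> u = v - 1)}"

lemma col_times_eq: "col_times \<omega> v = sorted_list_of_set (rung_times \<omega> v)"
  by (simp add: col_times_def rung_times_def)

lemma rung_times_subset: "rung_times \<omega> v \<subseteq> snd ` set \<omega>"
  by (force simp: rung_times_def)

lemma finite_rung_times [simp]: "finite (rung_times \<omega> v)"
  by (rule finite_subset[OF rung_times_subset]) simp

lemma sorted_list_of_set_image:
  fixes \<phi> :: "real \<Rightarrow> real"
  assumes "finite A" "strict_mono_on A \<phi>"
  shows "sorted_list_of_set (\<phi> ` A) = map \<phi> (sorted_list_of_set A)"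
proof -
  have "sorted_wrt (<) (map \<phi> (sorted_list_of_set A))"
    unfolding sorted_wrt_map
    by (rule sorted_wrt_mono_rel[OF _ strict_sorted_list_of_set])
       (use assms in \<open>auto simp: strict_mono_on_def\<close>)
  then have "sorted_list_of_set (set (map \<phi> (sorted_list_of_set A))) = map \<phi> (sorted_list_of_set A)"
    by (intro sorted_list_of_set.idem_if_sorted_distinct) (auto simp: strict_sorted_iff)
  then show ?thesis using assms by simp
qed

context
  fixes \<omega> \<omega>' :: "rung list" and \<phi> :: "real \<Rightarrow> real"
  assumes mono: "strict_mono_on (insert 0 (snd ` set \<omega>)) \<phi>" and zero: "\<phi> 0 = 0"
    and img: "set \<omega>' = apsnd \<phi> ` set \<omega>"
begin

lemma col_times_image: "col_times \<omega>' v = map \<phi> (col_times \<omega> v)"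
proof -
  have "rung_times \<omega>' v = \<phi> ` rung_times \<omega> v"
    by (force simp: rung_times_def img)
  moreover have "strict_mono_on (rung_times \<omega> v) \<phi>"
    by (rule monotone_on_subset[OF mono]) (use rung_times_subset in auto)
  ultimately show ?thesis by (simp add: col_times_eq sorted_list_of_set_image)
qed

text \<open>Including \<open>t = 0\<close> makes the row of spins at time 0 invariant as
  well.\<close>

lemma tidx_image:
  assumes "t \<in> insert 0 (snd ` set \<omega>)"
  shows "tidx \<omega>' v (\<phi> t) = tidx \<omega> v t"
proof -
  have "\<phi> s < \<phi> t \<longleftrightarrow> s < t" if "s \<in> set (col_times \<omega> v)" for s
    using strict_mono_on_less[OF mono, of s t] assms that rung_times_subset[of \<omega> v]
    by (auto simp: col_times_eq)
  then have "filter (\<lambda>s. \<phi> s < \<phi> t) (col_times \<omega> v) = filter (\<lambda>s. s < t) (col_times \<omega> v)"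
    by (intro filter_cong) auto
  then show ?thesis by (simp add: tidx_def col_times_image filter_map o_def)
qed

lemma pieces_image: "pieces L \<omega>' = pieces L \<omega>"
  by (simp add: pieces_def col_times_image)

lemma links_image: "links L \<omega>' = links L \<omega>"
proof -
  have t: "tidx \<omega>' v (\<phi> t) = tidx \<omega> v t" if "(u, t) \<in> set \<omega>" for u v t
    using that by (intro tidx_image) force
  \<comment> \<open>The parameter \<open>g\<close> treats the U-turns below and above the rungs by
    one argument.\<close>
  have "{(g u (tidx \<omega>' u t) (tidx \<omega>' (u+1) t)) | u t. (u, t) \<in> set \<omega>'} =
     {(g u (tidx \<omega> u t) (tidx \<omega> (u+1) t)) | u t. (u, t) \<in> set \<omega>}" for g :: "int \<Rightarrow> nat \<Rightarrow> nat \<Rightarrow> (int \<times> nat) \<times> (int \<times> nat)"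
  proof (intro subset_antisym subsetI)
    fix x assume "x \<in> {(g u (tidx \<omega>' u t) (tidx \<omega>' (u+1) t)) | u t. (u, t) \<in> set \<omega>'}"
    then obtain u t where ut: "(u, t) \<in> set \<omega>'" "x = g u (tidx \<omega>' u t) (tidx \<omega>' (u+1) t)" by blast
    then obtain s where "(u, s) \<in> set \<omega>" "t = \<phi> s" by (auto simp: img)
    then show "x \<in> {(g u (tidx \<omega> u t) (tidx \<omega> (u+1) t)) | u t. (u, t) \<in> set \<omega>}"
      using ut(2) t by auto
  next
    fix x assume "x \<in> {(g u (tidx \<omega> u t) (tidx \<omega> (u+1) t)) | u t. (u, t) \<in> set \<omega>}"
    then obtain u t where ut: "(u, t) \<in> set \<omega>" "x = g u (tidx \<omega> u t) (tidx \<omega> (u+1) t)" by blast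
    then have "(u, \<phi> t) \<in> set \<omega>'" "x = g u (tidx \<omega>' u (\<phi> t)) (tidx \<omega>' (u+1) (\<phi> t))"
      using t by (force simp: img)+
    then show "x \<in> {(g u (tidx \<omega>' u t) (tidx \<omega>' (u+1) t)) | u t. (u, t) \<in> set \<omega>'}" by blast
  qed
  from this[of "\<lambda>u i j. ((u, i), (u + 1, j))"] this[of "\<lambda>u i j. ((u, Suc i), (u + 1, Suc j))"]
  show ?thesis by (simp add: links_def col_times_image)
qed

lemma num_loops_image: "num_loops L \<omega>' = num_loops L \<omega>"
  by (simp add: num_loops_def loops_def pieces_image links_image)

lemma cond_exp_image: "cond_exp L lam s f \<omega>' = cond_exp L lam s f \<omega>"
proof -
  have "spins_at_0 L \<omega>' \<tau> = spins_at_0 L \<omega> \<tau>" for \<tau>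
    using tidx_image[of 0] by (auto simp: spins_at_0_def zero fun_eq_iff)
  then show ?thesis
    by (simp add: cond_exp_def num_loops_image pseudo_spins_def consistent_def loop_weight_def loops_def
        pieces_image links_image)
qed

end

lemma order_inv_num_loops: "order_inv (num_loops L)"
  unfolding order_inv_def using num_loops_image by blast

lemma order_inv_cond_exp: "order_inv (cond_exp L lam s f)"
  unfolding order_inv_def using cond_exp_image by blast

section \<open>Pieces and links computed from the word of edges alone\<close>

definition touching :: "int list \<Rightarrow> int \<Rightarrow> nat" where
  "touching r v = length (filter (\<lambda>u. u = v \<or> u = v - 1) r)"

text \<open>The head of a word is the latest rung.\<close>
fun rung_links :: "int list \<Rightarrow> ((int \<times> nat) \<times> (int \<times> nat)) list" where
  "rung_links [] = []"
| "rung_links (u # r) = ((u, Suc (touching r u)), (u + 1, Suc (touching r (u + 1))))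
     # ((u, touching r u), (u + 1, touching r (u + 1))) # rung_links r"

text \<open>Reversed, so that the list grows at its head as the pairs of columns are added from left
  to right; inductions on the number of caps follow this growth.\<close>

definition caps :: "nat \<Rightarrow> int list" where
  "caps L = map (\<lambda>j. - int L + 2 * int j + 1) (rev [0..<L])"

text \<open>The picture before its top caps are drawn: every column still has an open upper end, the
  piece with index \<open>touching r v\<close>.\<close>

definition open_links :: "nat \<Rightarrow> int list \<Rightarrow> ((int \<times> nat) \<times> (int \<times> nat)) list" where
  "open_links L r = rung_links r @ map (\<lambda>a. ((a, 0), (a + 1, 0))) (caps L)"

definition all_links :: "nat \<Rightarrow> int list \<Rightarrow> ((int \<times> nat) \<times> (int \<times> nat)) list" where
  "all_links L r = map (\<lambda>a. ((a, touching r a), (a + 1, touching r (a + 1)))) (caps L) @ open_links L r"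

definition word_pieces :: "nat \<Rightarrow> int list \<Rightarrow> (int \<times> nat) set" where
  "word_pieces L r = {(v, i). v \<in> sites L \<and> i \<le> touching r v}"

lemma set_caps: "set (caps L) = cap_cols L"
proof (intro subset_antisym subsetI)
  fix a assume "a \<in> cap_cols L"
  then obtain j where "a = - int L + 2 * j - 1" "1 \<le> j" "j \<le> int L" by (auto simp: cap_cols_def)
  then show "a \<in> set (caps L)"
    by (auto simp: caps_def intro!: image_eqI[of _ _ "nat (j - 1)"])
next
  fix a assume "a \<in> set (caps L)"
  then obtain j where "j < L" "a = - int L + 2 * int j + 1" by (auto simp: caps_def)
  then show "a \<in> cap_cols L" unfolding cap_cols_def
    by (intro CollectI exI[of _ "int j + 1"]) auto
qed

lemma col_times_zip:
  assumes "length r = length ts" "sorted_wrt (>) ts"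
  shows "col_times (zip r ts) v = rev (map snd (filter (\<lambda>(u, t). u = v \<or> u = v - 1) (zip r ts)))"
proof -
  let ?l = "rev (map snd (filter (\<lambda>(u, t). u = v \<or> u = v - 1) (zip r ts)))"
  have "sorted_wrt (>) (map snd (filter (\<lambda>(u, t). u = v \<or> u = v - 1) (zip r ts)))"
    using assms
  proof (induction r ts rule: list_induct2)
    case (Cons x xs y ys)
    then show ?case by (auto dest: set_zip_rightD)
  qed simp
  then have "sorted_wrt (<) ?l" by (simp add: sorted_wrt_rev)
  then have "sorted_list_of_set (set ?l) = ?l"
    by (intro sorted_list_of_set.idem_if_sorted_distinct) (auto simp: strict_sorted_iff)
  moreover have "set ?l = rung_times (zip r ts) v"
    by (force simp: rung_times_def)
  ultimately show ?thesis by (simp add: col_times_eq)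
qed

lemma length_filter_zip:
  "length r = length ts \<Longrightarrow> length (filter (\<lambda>(u, t). P u) (zip r ts)) = length (filter P r)"
  by (induction r ts rule: list_induct2) auto

lemma length_col_times_zip:
  assumes "length r = length ts" "sorted_wrt (>) ts"
  shows "length (col_times (zip r ts) v) = touching r v"
  using length_filter_zip[OF assms(1), of "\<lambda>u. u = v \<or> u = v - 1"]
  by (simp add: col_times_zip[OF assms] touching_def)

lemma pieces_zip:
  assumes "length r = length ts" "sorted_wrt (>) ts"
  shows "pieces L (zip r ts) = word_pieces L r"
  by (simp add: pieces_def word_pieces_def length_col_times_zip[OF assms])

lemma rung_links_zip:
  assumes "length r = length ts" "sorted_wrt (>) ts"
  shows "set (rung_links r) =
     {((u, tidx (zip r ts) u t), (u+1, tidx (zip r ts) (u+1) t)) | u t. (u, t) \<in> set (zip r ts)}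
   \<union> {((u, Suc (tidx (zip r ts) u t)), (u+1, Suc (tidx (zip r ts) (u+1) t))) | u t. (u, t) \<in> set (zip r ts)}"
  using assms
proof (induction r ts rule: list_induct2)
  case (Cons x xs y ys)
  let ?\<omega> = "zip (x # xs) (y # ys)"
  have less: "t < y" if "(u, t) \<in> set (zip xs ys)" for u t
    using that Cons.prems by (auto dest: set_zip_rightD)
  have s: "sorted_wrt (>) ys" using Cons.prems by simp
  \<comment> \<open>The new rung is the latest one, so its time is appended at the end and the
    indices at all earlier rungs are unchanged.\<close>
  have ct: "col_times ?\<omega> v = col_times (zip xs ys) v @ (if x = v \<or> x = v - 1 then [y] else [])" for v
    using Cons.prems Cons.hyps col_times_zip[OF Cons.hyps s, of v] col_times_zip[of "x # xs" "y # ys" v] by simp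
  have sub: "set (col_times (zip xs ys) v) \<subseteq> {..<y}" for v
    using less rung_times_subset[of "zip xs ys" v] by (fastforce simp: col_times_eq)
  have new: "tidx ?\<omega> v y = touching xs v" for v
  proof -
    have "filter (\<lambda>s. s < y) (col_times (zip xs ys) v) = col_times (zip xs ys) v"
      using sub[of v] by (auto simp: filter_id_conv)
    then show ?thesis unfolding tidx_def ct by (simp add: length_col_times_zip[OF Cons.hyps s])
  qed
  have old: "tidx ?\<omega> v t = tidx (zip xs ys) v t" if "(u, t) \<in> set (zip xs ys)" for u v t
    using less[OF that] unfolding tidx_def ct by simp
  have "{g u (tidx ?\<omega> u t) (tidx ?\<omega> (u+1) t) | u t. (u, t) \<in> set ?\<omega>} =
     insert (g x (touching xs x) (touching xs (x + 1)))
       {g u (tidx (zip xs ys) u t) (tidx (zip xs ys) (u+1) t) | u t. (u, t) \<in> set (zip xs ys)}"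
    for g :: "int \<Rightarrow> nat \<Rightarrow> nat \<Rightarrow> (int \<times> nat) \<times> (int \<times> nat)"
  proof -
    have "{g u (tidx ?\<omega> u t) (tidx ?\<omega> (u+1) t) | u t. (u, t) \<in> set ?\<omega>} =
      insert (g x (tidx ?\<omega> x y) (tidx ?\<omega> (x + 1) y))
       {g u (tidx ?\<omega> u t) (tidx ?\<omega> (u+1) t) | u t. (u, t) \<in> set (zip xs ys)}" by auto
    also have "{g u (tidx ?\<omega> u t) (tidx ?\<omega> (u+1) t) | u t. (u, t) \<in> set (zip xs ys)} =
       {g u (tidx (zip xs ys) u t) (tidx (zip xs ys) (u+1) t) | u t. (u, t) \<in> set (zip xs ys)}"
      by (rule Collect_cong) (metis old)
    finally show ?thesis by (simp only: new)
  qed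
  note this[of "\<lambda>u i j. ((u, i), (u + 1, j))"] this[of "\<lambda>u i j. ((u, Suc i), (u + 1, Suc j))"]
  then show ?case using Cons.IH[OF s] by (simp only: rung_links.simps list.simps(15)) blast
qed simp

lemma links_zip:
  assumes "length r = length ts" "sorted_wrt (>) ts"
  shows "links L (zip r ts) = set (all_links L r)"
  unfolding links_def all_links_def open_links_def set_append rung_links_zip[OF assms] set_map set_caps
    length_col_times_zip[OF assms]
  by blast

text \<open>Exactly the rungs of \<open>q\<close> lie below time 0, so the piece of a column that
  contains time 0 is the topmost one after drawing \<open>q\<close>.\<close>

lemma tidx_0_zip:
  assumes "length r = length ts" "length q = length us" "sorted_wrt (>) (ts @ us)"
    and "\<forall>x\<in>set ts. x > 0" "\<forall>x\<in>set us. x < 0"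
  shows "tidx (zip (r @ q) (ts @ us)) v 0 = touching q v"
proof -
  have "filter (\<lambda>(u, t). t < 0 \<and> (u = v \<or> u = v - 1)) (zip r ts) = []"
    using assms(4) by (force simp: filter_empty_conv dest: set_zip_rightD)
  moreover have "filter (\<lambda>(u, t). t < 0 \<and> (u = v \<or> u = v - 1)) (zip q us) =
       filter (\<lambda>(u, t). (u = v \<or> u = v - 1)) (zip q us)"
    by (rule filter_cong) (use assms(5) in \<open>force dest: set_zip_rightD\<close>)+
  ultimately have "length (filter (\<lambda>(u, t). t < 0 \<and> (u = v \<or> u = v - 1)) (zip r ts))
      + length (filter (\<lambda>(u, t). t < 0 \<and> (u = v \<or> u = v - 1)) (zip q us))
      = length (filter (\<lambda>(u, t). (u = v \<or> u = v - 1)) (zip q us))" by simp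
  then have "tidx (zip (r @ q) (ts @ us)) v 0 = length (filter (\<lambda>(u, t). (u = v \<or> u = v - 1)) (zip q us))"
    unfolding tidx_def using assms(1-3)
    by (subst col_times_zip) (simp_all add: rev_filter[symmetric] filter_map o_def case_prod_unfold conj_commute)
  then show ?thesis using length_filter_zip[OF assms(2), of "\<lambda>u. u = v \<or> u = v - 1"]
    by (simp add: touching_def)
qed

section \<open>Weights of loops\<close>

lemma touching_Cons:
  "touching (u # r) v = (if u = v \<or> u = v - 1 then Suc (touching r v) else touching r v)"
  by (simp add: touching_def)

lemma planar_state_empty: "planar_state {} {} [] f \<pi>"
  by unfold_locales auto

lemma planar_state_bottom:
  "\<exists>\<pi>. planar_state {- int L + 1..- int L + 2 * int n} ({- int L + 1..- int L + 2 * int n} \<times> {0})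
     (map (\<lambda>a. ((a, 0), (a + 1, 0))) (map (\<lambda>j. - int L + 2 * int j + 1) (rev [0..<n]))) (\<lambda>v. (v, 0)) \<pi>"
proof (induction n)
  case 0
  show ?case using planar_state_empty by (intro exI) simp
next
  case (Suc n)
  let ?S = "{- int L + 1..- int L + 2 * int n}" and ?u = "- int L + 2 * int n + 1"
  obtain \<pi> where "planar_state ?S (?S \<times> {0})
     (map (\<lambda>a. ((a, 0), (a + 1, 0))) (map (\<lambda>j. - int L + 2 * int j + 1) (rev [0..<n]))) (\<lambda>v. (v, 0)) \<pi>"
    using Suc by blast
  then interpret planar_state ?S "?S \<times> {0}"
     "map (\<lambda>a. ((a, 0), (a + 1, 0))) (map (\<lambda>j. - int L + 2 * int j + 1) (rev [0..<n]))" "\<lambda>v. (v, 0)" \<pi> .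
  have S: "{- int L + 1..- int L + 2 * int (Suc n)} = insert ?u (insert (?u + 1) ?S)" by auto
  have A: "{- int L + 1..- int L + 2 * int (Suc n)} \<times> {0} = insert (?u, 0) (insert (?u + 1, 0) (?S \<times> {0}))"
    by (auto simp: S)
  have t: "(\<lambda>v. (v, 0))(?u := (?u, 0), ?u + 1 := (?u + 1, 0)) = (\<lambda>v. (v, 0))" by auto
  show ?case
    using cup[of ?u 0 0, unfolded t] unfolding A unfolding S by auto
qed

lemma sites_caps: "sites L = {- int L + 1..- int L + 2 * int L}"
  by (simp add: sites_def)

text \<open>A rung joins the two open ends below it and starts a new pair above it: one
  \<open>cap\<close> followed by one \<open>cup\<close> at the same columns.\<close>

lemma planar_state_open:
  assumes "set r \<subseteq> edges L"
  shows "\<exists>\<pi>. planar_state (sites L) (word_pieces L r) (open_links L r) (\<lambda>v. (v, touching r v)) \<pi>"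
  using assms
proof (induction r)
  case Nil
  have "word_pieces L [] = sites L \<times> {0}" by (auto simp: word_pieces_def touching_def)
  then show ?case using planar_state_bottom[of L L]
    by (simp add: open_links_def caps_def touching_def sites_caps)
next
  case (Cons u r)
  then obtain \<pi> where "planar_state (sites L) (word_pieces L r) (open_links L r) (\<lambda>v. (v, touching r v)) \<pi>" by auto
  then interpret planar_state "sites L" "word_pieces L r" "open_links L r" "\<lambda>v. (v, touching r v)" \<pi> .
  have u: "u \<in> sites L" "u + 1 \<in> sites L" using Cons.prems edges_sites by auto
  let ?i = "Suc (touching r u)" and ?j = "Suc (touching r (u + 1))"
  have A: "word_pieces L (u # r) = insert (u, ?i) (insert (u + 1, ?j) (word_pieces L r))"
    using u by (auto simp: word_pieces_def touching_Cons le_Suc_eq split: if_splits)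
  have t: "(\<lambda>v. (v, touching r v))(u := (u, ?i), u + 1 := (u + 1, ?j)) = (\<lambda>v. (v, touching (u # r) v))"
    by (auto simp: touching_Cons)
  have S: "insert u (insert (u + 1) (sites L - {u, u + 1})) = sites L" using u by auto
  have new: "(u, ?i) \<notin> word_pieces L r" "(u + 1, ?j) \<notin> word_pieces L r" by (auto simp: word_pieces_def)
  have E: "open_links L (u # r) = ((u, ?i), (u + 1, ?j)) # ((u, touching r u), (u + 1, touching r (u + 1))) # open_links L r"
    by (simp add: open_links_def)
  from planar_state.cup[OF cap[OF u], of u ?i "?j"] new
  show ?case unfolding A E t S by auto
qed

text \<open>The top caps close the columns in pairs from left to right. Once no open end is left,
  every component is a loop and \<open>closed\<close> yields its turning number.\<close>

lemma planar_state_closed: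
  assumes "set r \<subseteq> edges L"
  shows "\<exists>\<pi>. planar_state {} (word_pieces L r) (all_links L r) (\<lambda>v. (v, touching r v)) \<pi>"
proof -
  let ?E = "\<lambda>n. map (\<lambda>a. ((a, touching r a), (a + 1, touching r (a + 1))))
     (map (\<lambda>j. - int L + 2 * int j + 1) (rev [0..<n])) @ open_links L r"
  have "\<exists>\<pi>. planar_state {- int L + 2 * int n + 1..int L} (word_pieces L r) (?E n) (\<lambda>v. (v, touching r v)) \<pi>"
    if "n \<le> L" for n
    using that
  proof (induction n)
    case 0
    then show ?case using planar_state_open[OF assms] by (simp add: sites_def)
  next
    case (Suc n)
    let ?u = "- int L + 2 * int n + 1" and ?S = "{- int L + 2 * int n + 1..int L}"
    obtain \<pi> where "planar_state ?S (word_pieces L r) (?E n) (\<lambda>v. (v, touching r v)) \<pi>" using Suc by auto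
    then interpret planar_state ?S "word_pieces L r" "?E n" "\<lambda>v. (v, touching r v)" \<pi> .
    have S: "{- int L + 2 * int (Suc n) + 1..int L} = ?S - {?u, ?u + 1}" by auto
    show ?case using cap[of ?u] Suc.prems unfolding S by auto
  qed
  from this[of L] show ?thesis by (simp add: all_links_def caps_def)
qed

section \<open>From turning numbers to weights of oriented loops\<close>

lemma sum_list_sum_swap:
  "(\<Sum>x\<leftarrow>xs. \<Sum>c\<in>C. f x c) = (\<Sum>c\<in>C. \<Sum>x\<leftarrow>xs. f x c)"
  by (induction xs) (simp_all add: sum.distrib)

lemma links_columns:
  "(p, q) \<in> set (all_links L r) \<Longrightarrow> fst q = fst p + 1"
proof -
  have "(p, q) \<in> set (rung_links r) \<Longrightarrow> fst q = fst p + 1"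
    by (induction r) auto
  then show "(p, q) \<in> set (all_links L r) \<Longrightarrow> fst q = fst p + 1"
    by (auto simp: all_links_def open_links_def)
qed

text \<open>Links join neighbouring columns, so a consistent orientation of a component is a global
  sign times the parity of the column. The sum of the signs of the U-turns of a loop then
  only depends on the link structure, and is governed by the leftmost column of the loop.\<close>

locale closed_links =
  fixes A :: "(int \<times> nat) set" and E :: "((int \<times> nat) \<times> (int \<times> nat)) list"
  assumes finA: "finite A" and EA: "set E \<subseteq> A \<times> A"
    and columns: "(p, q) \<in> set E \<Longrightarrow> fst q = fst p + 1"
    and turning_loop: "p \<in> A \<Longrightarrow> turning E (component E p) = 2 * col_sign (mincol (component E p))"
begin

definition consistent_spin :: "(int \<times> nat \<Rightarrow> int) \<Rightarrow> bool" where
  "consistent_spin \<tau> \<longleftrightarrow> (\<forall>(p, q)\<in>set E. \<tau> p = - \<tau> q)"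

abbreviation loop_set :: "(int \<times> nat) set set" where
  "loop_set \<equiv> A // conn E"

lemma loop_set_eq: "loop_set = component E ` A"
  by (auto simp: quotient_def component_def)

lemma finite_loop_set: "finite loop_set"
  using finA by (simp add: loop_set_eq)

lemma loop_subset: "p \<in> A \<Longrightarrow> component E p \<subseteq> A"
  by (rule component_subset[OF EA])

lemma finite_loop: "p \<in> A \<Longrightarrow> finite (component E p)"
  using loop_subset finA finite_subset by blast

lemma mincol_attained:
  assumes "p \<in> A"
  obtains m where "m \<in> component E p" "m \<in> A" "fst m = mincol (component E p)"
proof -
  have "component E p \<noteq> {}" using self_in_component[of p E] by (metis empty_iff)
  then have "mincol (component E p) \<in> fst ` component E p"
    unfolding mincol_def using finite_loop[OF assms] by (intro Min_in) auto
  then show thesis using that loop_subset[OF assms] by auto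
qed

lemma col_sign_sq: "col_sign v * col_sign v = 1"
  by (simp add: col_sign_def)

lemma spin_sign_const:
  assumes "consistent_spin \<tau>" "q \<in> component E p"
  shows "\<tau> q * col_sign (fst q) = \<tau> p * col_sign (fst p)"
proof -
  have step: "\<tau> z * col_sign (fst z) = \<tau> y * col_sign (fst y)" if "(y, z) \<in> set E" for y z
    using that assms(1) columns[OF that] by (auto simp: consistent_spin_def col_sign_def)
  have "(p, q) \<in> (set E \<union> (set E)\<inverse>)\<^sup>*"
    using assms(2) by (simp add: component_def conn_def)
  then show ?thesis
  proof (induction rule: rtrancl_induct)
    case (step y z)
    then show ?case using \<open>\<And>y z. (y, z) \<in> set E \<Longrightarrow> _\<close>[of y z] \<open>\<And>y z. (y, z) \<in> set E \<Longrightarrow> _\<close>[of z y] by auto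
  qed simp
qed

lemma spin_set_cases: "\<tau> \<in> spin_set A \<Longrightarrow> p \<in> A \<Longrightarrow> \<tau> p = 1 \<or> \<tau> p = - 1"
  by (auto simp: spin_set_def)

text \<open>A consistent spin is a constant sign times the column parity on a loop, so all its
  pieces in the leftmost column agree and the orientation can be tested at any piece
  \<open>p\<close>.\<close>

lemma is_ccw_iff:
  assumes "\<tau> \<in> spin_set A" "consistent_spin \<tau>" "p \<in> A"
  shows "is_ccw (component E p) \<tau> \<longleftrightarrow> \<tau> p * col_sign (fst p) * col_sign (mincol (component E p)) = - 1"
proof -
  have *: "\<tau> q = \<tau> p * col_sign (fst p) * col_sign (mincol (component E p))"
    if "q \<in> component E p" "fst q = mincol (component E p)" for q
    using spin_sign_const[OF assms(2) that(1)] that(2) col_sign_sq[of "fst q"]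
    by (metis mult.assoc mult.right_neutral)
  obtain m where "m \<in> component E p" "fst m = mincol (component E p)"
    using mincol_attained[OF assms(3)] by metis
  then show ?thesis using * unfolding is_ccw_def mincol_def by metis
qed

text \<open>Each link belongs to exactly one loop, and on a loop the spin is a constant sign times
  the parity sign; hence each loop contributes that sign times its turning number.\<close>

lemma sum_links_left:
  assumes "\<tau> \<in> spin_set A" "consistent_spin \<tau>"
  shows "(\<Sum>(p, q)\<leftarrow>E. \<tau> p) = (\<Sum>C\<in>loop_set. if is_ccw C \<tau> then - 2 else 2)"
proof -
  have one: "(\<Sum>C\<in>loop_set. if p \<in> C then \<tau> p else 0) = \<tau> p" if "p \<in> A" for p
  proof -
    have "p \<in> C \<longleftrightarrow> C = component E p" if "C \<in> loop_set" for C
    proof -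
      obtain q where "C = component E q" using \<open>C \<in> loop_set\<close> by (auto simp: loop_set_eq)
      then show ?thesis by (simp add: component_eq_iff)
    qed
    then have "(\<Sum>C\<in>loop_set. if p \<in> C then \<tau> p else 0) = (\<Sum>C\<in>loop_set. if C = component E p then \<tau> p else 0)"
      by (intro sum.cong) auto
    then show ?thesis using that finite_loop_set by (simp add: loop_set_eq)
  qed
  have "(case x of (p, q) \<Rightarrow> \<tau> p) = (case x of (p, q) \<Rightarrow> \<Sum>C\<in>loop_set. if p \<in> C then \<tau> p else 0)"
    if "x \<in> set E" for x
  proof -
    obtain p q where x: "x = (p, q)" by (cases x)
    then have "p \<in> A" using that EA by blast
    then show ?thesis by (simp add: x one)
  qed
  then have "(\<Sum>(p, q)\<leftarrow>E. \<tau> p) = (\<Sum>(p, q)\<leftarrow>E. \<Sum>C\<in>loop_set. if p \<in> C then \<tau> p else 0)"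
    by (intro arg_cong[of _ _ sum_list] map_cong refl)
  also have "\<dots> = (\<Sum>C\<in>loop_set. \<Sum>(p, q)\<leftarrow>E. if p \<in> C then \<tau> p else 0)"
    unfolding case_prod_unfold by (rule sum_list_sum_swap)
  also have "\<dots> = (\<Sum>C\<in>loop_set. if is_ccw C \<tau> then - 2 else 2)"
  proof (rule sum.cong[OF refl])
    fix C assume "C \<in> loop_set"
    then obtain p where p: "p \<in> A" "C = component E p" by (auto simp: loop_set_eq)
    define s where "s = \<tau> p * col_sign (fst p)"
    have val: "\<tau> x = s * col_sign (fst x)" if "x \<in> C" for x
      using spin_sign_const[OF assms(2)] that p(2) col_sign_sq[of "fst x"] unfolding s_def
      by (metis mult.assoc mult.right_neutral)
    have "(\<Sum>(p, q)\<leftarrow>E. if p \<in> C then \<tau> p else 0) = (\<Sum>(p, q)\<leftarrow>E. s * (if p \<in> C then col_sign (fst p) else 0))"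
      using val by (intro arg_cong[of _ _ sum_list] map_cong refl) (simp add: case_prod_unfold)
    also have "\<dots> = s * turning E C"
      unfolding turning_def case_prod_unfold by (rule sum_list_const_mult)
    also have "\<dots> = 2 * (s * col_sign (mincol C))"
      using turning_loop[OF p(1)] p(2) by simp
    also have "\<dots> = (if is_ccw C \<tau> then - 2 else 2)"
    proof -
      have "s * col_sign (mincol C) = 1 \<or> s * col_sign (mincol C) = - 1"
        using spin_set_cases[OF assms(1) p(1)] by (auto simp: s_def col_sign_def)
      then show ?thesis using is_ccw_iff[OF assms p(1)] p(2) s_def by auto
    qed
    finally show "(\<Sum>(p, q)\<leftarrow>E. if p \<in> C then \<tau> p else 0) = (if is_ccw C \<tau> then - 2 else 2)" .
  qed
  finally show ?thesis .
qed

text \<open>The spins at the left ends of the U-turns add up to -2 on a counterclockwise loop, and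
  with the exponent -l/2 per unit of spin this is exp(l). A violated link contributes a zero
  factor.\<close>

lemma amp_prod_eq:
  assumes "\<tau> \<in> spin_set A"
  shows "(\<Prod>(p, q)\<leftarrow>E. amp l (\<tau> p) (\<tau> q)) =
    (if consistent_spin \<tau> then \<Prod>C\<in>loop_set. if is_ccw C \<tau> then exp l else exp (- l) else 0)"
proof (cases "consistent_spin \<tau>")
  case True
  have "(\<Prod>(p, q)\<leftarrow>F. amp l (\<tau> p) (\<tau> q)) = exp (- l / 2 * real_of_int (\<Sum>(p, q)\<leftarrow>F. \<tau> p))"
    if "set F \<subseteq> set E" for F
    using that
  proof (induction F)
    case (Cons x F)
    obtain p q where "x = (p, q)" by (cases x)
    then have "amp l (\<tau> p) (\<tau> q) = exp (- l / 2 * real_of_int (\<tau> p))"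
      using True Cons.prems by (auto simp: consistent_spin_def amp_def)
    then show ?case using Cons \<open>x = (p, q)\<close> by (simp add: algebra_simps flip: exp_add)
  qed simp
  then have "(\<Prod>(p, q)\<leftarrow>E. amp l (\<tau> p) (\<tau> q)) = exp (- l / 2 * real_of_int (\<Sum>(p, q)\<leftarrow>E. \<tau> p))" by blast
  also have "\<dots> = exp (\<Sum>C\<in>loop_set. if is_ccw C \<tau> then l else - l)"
    unfolding sum_links_left[OF assms True] of_int_sum sum_distrib_left
    by (intro arg_cong[of _ _ exp] sum.cong) auto
  also have "\<dots> = (\<Prod>C\<in>loop_set. if is_ccw C \<tau> then exp l else exp (- l))"
    by (subst exp_sum[OF finite_loop_set]) (intro prod.cong, auto)
  finally show ?thesis using True by simp
next
  case False
  then obtain p q where "(p, q) \<in> set E" "\<tau> p \<noteq> - \<tau> q" by (auto simp: consistent_spin_def)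
  then have "0 \<in> set (map (\<lambda>(p, q). amp l (\<tau> p) (\<tau> q)) E)"
    by (force simp: amp_def)
  then show ?thesis using False by (simp add: prod_list_zero_iff)
qed

text \<open>Consistent spins amount to an independent choice of orientation for every loop, so the
  sum factorizes over the loops.\<close>

lemma sum_amp_prod:
  "(\<Sum>\<tau>\<in>spin_set A. \<Prod>(p, q)\<leftarrow>E. amp l (\<tau> p) (\<tau> q)) = (exp l + exp (- l)) ^ card loop_set"
proof -
  define w where "w x = (if x = - 1 then exp l else exp (- l))" for x :: int
  define orient where "orient \<tau> = (\<lambda>C\<in>loop_set. if is_ccw C \<tau> then - 1 else (1::int))" for \<tau>
  \<comment> \<open>The orientation that has value \<open>g C\<close> in the leftmost column of each
    loop \<open>C\<close> and alternates with the column parity.\<close>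
  define spin where "spin g p = (if p \<in> A then g (component E p) * col_sign (mincol (component E p)) * col_sign (fst p) else 0)"
    for g :: "(int \<times> nat) set \<Rightarrow> int" and p
  have comp_in: "component E p \<in> loop_set" if "p \<in> A" for p using that by (simp add: loop_set_eq)
  have spin_in: "spin g \<in> spin_set A" "consistent_spin (spin g)"
    and orient_spin: "orient (spin g) = g" if g: "g \<in> PiE loop_set (\<lambda>_. {- 1, 1})" for g
  proof -
    have gv: "g C = 1 \<or> g C = - 1" if "C \<in> loop_set" for C using g that by auto
    show 1: "spin g \<in> spin_set A"
      using gv comp_in by (force simp: spin_set_def spin_def col_sign_def)
    show 2: "consistent_spin (spin g)"
      unfolding consistent_spin_def
    proof clarify
      fix a b c d assume e: "((a, b), (c, d)) \<in> set E"
      then have "(c, d) \<in> component E (a, b)" by (auto simp: component_def conn_def)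
      then have "component E (a, b) = component E (c, d)" by (simp add: component_eq_iff)
      then show "spin g (a, b) = - spin g (c, d)"
        using e EA columns[OF e] by (auto simp: spin_def col_sign_def)
    qed
    show "orient (spin g) = g"
    proof
      fix C show "orient (spin g) C = g C"
      proof (cases "C \<in> loop_set")
        case True
        then obtain p where p: "p \<in> A" "C = component E p" by (auto simp: loop_set_eq)
        have "is_ccw C (spin g) \<longleftrightarrow> g C = - 1"
          using is_ccw_iff[OF 1 2 p(1)] p gv[OF True]
          by (auto simp: spin_def col_sign_def split: if_splits)
        then show ?thesis using gv[OF True] True by (auto simp: orient_def)
      next
        case False
        then show ?thesis using g by (auto simp: orient_def PiE_def extensional_def)
      qed
    qed
  qed
  have spin_orient: "spin (orient \<tau>) = \<tau>" if \<tau>: "\<tau> \<in> spin_set A" "consistent_spin \<tau>" for \<tau>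
  proof
    fix p show "spin (orient \<tau>) p = \<tau> p"
    proof (cases "p \<in> A")
      case True
      then show ?thesis using is_ccw_iff[OF \<tau> True] spin_set_cases[OF \<tau>(1) True] comp_in[OF True]
        by (auto simp: spin_def orient_def col_sign_def split: if_splits)
    next
      case False
      then show ?thesis using \<tau>(1) by (cases p) (simp add: spin_def spin_set_def)
    qed
  qed
  have "(\<Sum>\<tau>\<in>spin_set A. \<Prod>(p, q)\<leftarrow>E. amp l (\<tau> p) (\<tau> q))
     = (\<Sum>\<tau>\<in>{\<tau>\<in>spin_set A. consistent_spin \<tau>}. \<Prod>C\<in>loop_set. if is_ccw C \<tau> then exp l else exp (- l))"
    using finite_spin_set[OF finA] by (simp add: amp_prod_eq sum.inter_filter)
  also have "\<dots> = (\<Sum>g\<in>PiE loop_set (\<lambda>_. {- 1, 1}). \<Prod>C\<in>loop_set. w (g C))"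
  proof (rule sum.reindex_bij_witness[of _ spin orient])
    fix \<tau> assume "\<tau> \<in> {\<tau> \<in> spin_set A. consistent_spin \<tau>}"
    then show "spin (orient \<tau>) = \<tau>" using spin_orient by auto
    show "orient \<tau> \<in> PiE loop_set (\<lambda>_. {- 1, 1})" by (auto simp: orient_def)
    show "(\<Prod>C\<in>loop_set. w (orient \<tau> C)) = (\<Prod>C\<in>loop_set. if is_ccw C \<tau> then exp l else exp (- l))"
      by (intro prod.cong) (auto simp: orient_def w_def)
  qed (use spin_in orient_spin in auto)
  also have "\<dots> = (\<Prod>C\<in>loop_set. \<Sum>x\<in>{- 1, 1}. w x)"
    by (rule prod_sum_PiE[symmetric]) (auto simp: finite_loop_set)
  finally show ?thesis by (simp add: w_def)
qed

end

lemma closed_links_word: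
  assumes "set r \<subseteq> edges L"
  shows "closed_links (word_pieces L r) (all_links L r)"
proof -
  obtain \<pi> where "planar_state {} (word_pieces L r) (all_links L r) (\<lambda>v. (v, touching r v)) \<pi>"
    using planar_state_closed[OF assms] by blast
  then interpret planar_state "{}" "word_pieces L r" "all_links L r" "\<lambda>v. (v, touching r v)" \<pi> .
  show ?thesis
    by unfold_locales (use finA EA closed links_columns in auto)
qed

text \<open>The loop factor of the measure cancels the normalization in \<open>cond_exp\<close>, so
  numerator and denominator both become sums of local products over links.\<close>

lemma loop_weight_word:
  assumes r: "set r \<subseteq> edges L" and len: "length r = length ts" and ts: "sorted_wrt (>) ts"
    and lam: "sqrtQ lam = exp (s * lam) + exp (- (s * lam))"
  shows "sqrtQ lam ^ num_loops L (zip r ts) = (\<Sum>\<tau>\<in>spin_set (word_pieces L r). \<Prod>(p, q)\<leftarrow>all_links L r. amp (s * lam) (\<tau> p) (\<tau> q))"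
    and "sqrtQ lam ^ num_loops L (zip r ts) * cond_exp L lam s f (zip r ts) =
      (\<Sum>\<tau>\<in>spin_set (word_pieces L r). (\<Prod>(p, q)\<leftarrow>all_links L r. amp (s * lam) (\<tau> p) (\<tau> q)) * f (spins_at_0 L (zip r ts) \<tau>))"
proof -
  interpret closed_links "word_pieces L r" "all_links L r" by (rule closed_links_word[OF r])
  have loops: "loops L (zip r ts) = loop_set"
    by (simp add: loops_def conn_def pieces_zip[OF len ts] links_zip[OF len ts])
  show "sqrtQ lam ^ num_loops L (zip r ts) = (\<Sum>\<tau>\<in>spin_set (word_pieces L r). \<Prod>(p, q)\<leftarrow>all_links L r. amp (s * lam) (\<tau> p) (\<tau> q))"
    unfolding sum_amp_prod by (simp add: num_loops_def loops lam)
  have pos: "sqrtQ lam ^ num_loops L (zip r ts) \<noteq> 0"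
    by (simp add: sqrtQ_def add_pos_pos less_imp_neq[symmetric])
  have "pseudo_spins L (zip r ts) = spin_set (word_pieces L r)"
    by (simp add: pseudo_spins_def spin_set_def pieces_zip[OF len ts])
  moreover have weight: "loop_weight L lam s (zip r ts) \<tau> =
      (\<Prod>C\<in>loop_set. if is_ccw C \<tau> then exp (s * lam) else exp (- (s * lam)))" for \<tau>
    unfolding loop_weight_def loops mult_minus_left by (rule refl)
  moreover have "consistent L (zip r ts) \<tau> = consistent_spin \<tau>" for \<tau>
    by (simp add: consistent_def consistent_spin_def links_zip[OF len ts])
  ultimately show "sqrtQ lam ^ num_loops L (zip r ts) * cond_exp L lam s f (zip r ts) =
      (\<Sum>\<tau>\<in>spin_set (word_pieces L r). (\<Prod>(p, q)\<leftarrow>all_links L r. amp (s * lam) (\<tau> p) (\<tau> q)) * f (spins_at_0 L (zip r ts) \<tau>))"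
    using pos by (simp add: cond_exp_def amp_prod_eq weight) (intro sum.cong refl, simp)
qed

section \<open>Transfer operators\<close>

lemma touching_append: "touching (r @ q) v = touching r v + touching q v"
  by (simp add: touching_def)

lemma tl_act_cong:
  "(\<And>y. y \<in> confs L \<Longrightarrow> \<phi> y = \<psi> y) \<Longrightarrow> tl_act L l u \<phi> x = tl_act L l u \<psi> x"
  by (simp add: tl_act_def cong: sum.cong)

lemma seed_re_caps: "seed_re L l \<sigma> = (\<Prod>a\<leftarrow>caps L. amp l (\<sigma> a) (\<sigma> (a + 1)))"
proof -
  have "seed_re L l \<sigma> = (\<Prod>j<L. amp l (\<sigma> (- int L + 2 * int j + 1)) (\<sigma> (- int L + 2 * int j + 2)))"
    unfolding seed_re_def
    by (rule prod.reindex_bij_witness[of _ "\<lambda>j. int j + 1" "\<lambda>j. nat (j - 1)"]) (auto simp: algebra_simps)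
  also have "\<dots> = (\<Prod>j\<leftarrow>rev [0..<L]. amp l (\<sigma> (- int L + 2 * int j + 1)) (\<sigma> (- int L + 2 * int j + 2)))"
    by (simp add: prod.distinct_set_conv_list[symmetric] atLeast0LessThan flip: rev_map)
  finally show ?thesis by (simp add: caps_def o_def add.assoc)
qed

section \<open>State sums as iterated bond operators\<close>

definition top_conf :: "int list \<Rightarrow> (int \<times> nat \<Rightarrow> int) \<Rightarrow> int \<Rightarrow> int" where
  "top_conf r \<tau> = (\<lambda>v. \<tau> (v, touching r v))"

definition links_weight :: "real \<Rightarrow> ((int \<times> nat) \<times> (int \<times> nat)) list \<Rightarrow> (int \<times> nat \<Rightarrow> int) \<Rightarrow> real" where
  "links_weight l E \<tau> = (\<Prod>(p, q)\<leftarrow>E. amp l (\<tau> p) (\<tau> q))"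

text \<open>The partition function of the part drawn so far, as a vector indexed by its top row
  \<open>\<sigma>\<close>; \<open>g\<close> carries an observable on earlier rows.\<close>

definition state_sum :: "nat \<Rightarrow> real \<Rightarrow> int list \<Rightarrow> ((int \<times> nat \<Rightarrow> int) \<Rightarrow> real) \<Rightarrow> (int \<Rightarrow> int) \<Rightarrow> real" where
  "state_sum L l r g \<sigma> = (\<Sum>\<tau>\<in>{\<tau>\<in>spin_set (word_pieces L r). top_conf r \<tau> = \<sigma>}.
     links_weight l (open_links L r) \<tau> * g \<tau>)"

lemma finite_word_pieces [simp]: "finite (word_pieces L r)"
proof -
  have "word_pieces L r = (SIGMA v:sites L. {..touching r v})" by (auto simp: word_pieces_def)
  then show ?thesis by (simp add: sites_def)
qed

lemma top_conf_in: "\<tau> \<in> spin_set (word_pieces L r) \<Longrightarrow> top_conf r \<tau> \<in> confs L"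
  by (auto simp: top_conf_def confs_eq spin_set_def word_pieces_def)

lemma links_weight_cong:
  assumes "\<And>p q. (p, q) \<in> set E \<Longrightarrow> \<tau> p = \<tau>' p \<and> \<tau> q = \<tau>' q"
  shows "links_weight l E \<tau> = links_weight l E \<tau>'"
  unfolding links_weight_def
  by (intro arg_cong[of _ _ prod_list] map_cong refl) (use assms in auto)

lemma open_links_pieces:
  assumes "set r \<subseteq> edges L"
  shows "set (open_links L r) \<subseteq> word_pieces L r \<times> word_pieces L r"
  using assms
proof (induction r)
  case Nil
  have "a \<in> sites L \<and> a + 1 \<in> sites L" if "a \<in> set (caps L)" for a
    using that by (auto simp: caps_def sites_def)
  then show ?case by (auto simp: open_links_def word_pieces_def)
next
  case (Cons u r)
  have u: "u \<in> sites L" "u + 1 \<in> sites L" using Cons.prems edges_sites by auto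
  have sub: "word_pieces L r \<subseteq> word_pieces L (u # r)"
    by (auto simp: word_pieces_def touching_def)
  have "set (open_links L r) \<subseteq> word_pieces L (u # r) \<times> word_pieces L (u # r)"
    using Cons.IH Cons.prems sub by (meson Sigma_mono order_trans set_subset_Cons)
  moreover have "set (open_links L (u # r)) =
     {((u, Suc (touching r u)), (u + 1, Suc (touching r (u + 1)))), ((u, touching r u), (u + 1, touching r (u + 1)))}
     \<union> set (open_links L r)" by (auto simp: open_links_def)
  moreover have "(u, Suc (touching r u)) \<in> word_pieces L (u # r)" "(u + 1, Suc (touching r (u + 1))) \<in> word_pieces L (u # r)"
    "(u, touching r u) \<in> word_pieces L (u # r)" "(u + 1, touching r (u + 1)) \<in> word_pieces L (u # r)"
    using u by (auto simp: word_pieces_def touching_def)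
  ultimately show ?case by simp
qed

lemma sum_top_conf:
  "(\<Sum>\<sigma>\<in>confs L. h \<sigma> * state_sum L l r g \<sigma>) =
    (\<Sum>\<tau>\<in>spin_set (word_pieces L r). h (top_conf r \<tau>) * (links_weight l (open_links L r) \<tau> * g \<tau>))"
proof -
  have fin: "finite (spin_set (word_pieces L r))" by (simp add: finite_spin_set)
  have "(\<Sum>\<tau>\<in>spin_set (word_pieces L r). h (top_conf r \<tau>) * (links_weight l (open_links L r) \<tau> * g \<tau>)) =
    (\<Sum>\<sigma>\<in>confs L. \<Sum>\<tau>\<in>{\<tau>\<in>spin_set (word_pieces L r). top_conf r \<tau> = \<sigma>}.
        h (top_conf r \<tau>) * (links_weight l (open_links L r) \<tau> * g \<tau>))"
    by (rule sum.group[symmetric]) (use fin top_conf_in in auto)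
  also have "\<dots> = (\<Sum>\<sigma>\<in>confs L. h \<sigma> * state_sum L l r g \<sigma>)"
    unfolding state_sum_def sum_distrib_left by (intro sum.cong) auto
  finally show ?thesis by simp
qed

text \<open>The two pieces above the rung are prescribed by \<open>\<sigma>\<close>, while the
  former top pieces at \<open>u\<close> and \<open>u + 1\<close> become interior and are summed
  over, as in the matrix product. The two U-turns at the rung supply the two factors
  \<open>amp\<close> of \<open>tl_gen\<close>.\<close>

lemma state_sum_Cons:
  assumes r: "set (u # r) \<subseteq> edges L" and \<sigma>: "\<sigma> \<in> confs L"
    and g: "\<And>\<tau> a b. g (\<tau>((u, Suc (touching r u)) := a, (u + 1, Suc (touching r (u + 1))) := b)) = g \<tau>"
  shows "state_sum L l (u # r) g \<sigma> = tl_act L l u (state_sum L l r g) \<sigma>"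
proof -
  let ?p = "(u, Suc (touching r u))" and ?q = "(u + 1, Suc (touching r (u + 1)))"
  let ?A = "word_pieces L r" and ?A' = "word_pieces L (u # r)"
  \<comment> \<open>Restriction resets the new pieces to 0, the value that \<open>spin_set\<close>
    prescribes off the pieces of the shorter word.\<close>
  let ?ext = "\<lambda>\<tau>. \<tau>(?p := \<sigma> u, ?q := \<sigma> (u + 1))" and ?res = "\<lambda>\<tau>. \<tau>(?p := 0, ?q := (0::int))"
  have u: "u \<in> sites L" "u + 1 \<in> sites L" using r edges_sites by auto
  have t: "touching (u # r) v = (if v = u \<or> v = u + 1 then Suc (touching r v) else touching r v)" for v
    by (auto simp: touching_def)
  have A': "?A' = insert ?p (insert ?q ?A)"
    using u by (auto simp: word_pieces_def t le_Suc_eq split: if_splits)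
  have notin: "?p \<notin> ?A" "?q \<notin> ?A" by (auto simp: word_pieces_def)
  have \<sigma>v: "\<sigma> u \<in> {- 1, 1}" "\<sigma> (u + 1) \<in> {- 1, 1}" using u \<sigma> by (auto simp: confs_def)
  have sub: "set (open_links L r) \<subseteq> ?A \<times> ?A" using r by (intro open_links_pieces) simp
  have top_ext: "top_conf (u # r) (?ext \<tau>) = \<sigma> \<longleftrightarrow> bond u \<sigma> (top_conf r \<tau>)" for \<tau>
    by (auto simp: top_conf_def t bond_def fun_eq_iff)
  have w: "links_weight l (open_links L (u # r)) (?ext \<tau>) =
      amp l (\<sigma> u) (\<sigma> (u + 1)) * amp l (top_conf r \<tau> u) (top_conf r \<tau> (u + 1)) * links_weight l (open_links L r) \<tau>" for \<tau>
  proof -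
    have "links_weight l (open_links L r) (?ext \<tau>) = links_weight l (open_links L r) \<tau>"
      by (rule links_weight_cong) (use sub notin in auto)
    then show ?thesis by (simp add: open_links_def links_weight_def top_conf_def)
  qed
  have "state_sum L l (u # r) g \<sigma> = (\<Sum>\<tau>\<in>{\<tau>\<in>spin_set ?A. bond u \<sigma> (top_conf r \<tau>)}.
     amp l (\<sigma> u) (\<sigma> (u + 1)) * amp l (top_conf r \<tau> u) (top_conf r \<tau> (u + 1)) * links_weight l (open_links L r) \<tau> * g \<tau>)"
    unfolding state_sum_def
  proof (rule sum.reindex_bij_witness[of _ ?ext ?res])
    fix \<tau> assume \<tau>: "\<tau> \<in> {\<tau>\<in>spin_set ?A'. top_conf (u # r) \<tau> = \<sigma>}"
    then have top: "\<tau> ?p = \<sigma> u" "\<tau> ?q = \<sigma> (u + 1)"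
      by (auto simp: top_conf_def t)
    show er: "?ext (?res \<tau>) = \<tau>" using top by (auto simp: fun_eq_iff)
    then show "?res \<tau> \<in> {\<tau>\<in>spin_set ?A. bond u \<sigma> (top_conf r \<tau>)}"
      using \<tau> top_ext[of "?res \<tau>"] notin by (auto simp: spin_set_def A')
    show "amp l (\<sigma> u) (\<sigma> (u + 1)) * amp l (top_conf r (?res \<tau>) u) (top_conf r (?res \<tau>) (u + 1))
        * links_weight l (open_links L r) (?res \<tau>) * g (?res \<tau>)
      = links_weight l (open_links L (u # r)) \<tau> * g \<tau>"
      unfolding w[of "?res \<tau>", symmetric] er g by (rule refl)
  next
    fix \<tau> assume \<tau>: "\<tau> \<in> {\<tau>\<in>spin_set ?A. bond u \<sigma> (top_conf r \<tau>)}"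
    then have "\<tau> ?p = 0" "\<tau> ?q = 0" using notin by (auto simp: spin_set_def)
    then show "?res (?ext \<tau>) = \<tau>" by (auto simp: fun_eq_iff)
    show "?ext \<tau> \<in> {\<tau>\<in>spin_set ?A'. top_conf (u # r) \<tau> = \<sigma>}"
      using \<tau> top_ext[of \<tau>] \<sigma>v by (auto simp: spin_set_def A')
  qed
  also have "\<dots> = (\<Sum>\<tau>\<in>spin_set ?A. tl_gen l u \<sigma> (top_conf r \<tau>) * (links_weight l (open_links L r) \<tau> * g \<tau>))"
    by (subst sum.inter_filter, simp add: finite_spin_set)
       (intro sum.cong, auto simp: tl_gen_def)
  finally show ?thesis
    by (simp add: tl_act_def sum_top_conf)
qed

lemma state_sum_Nil:
  assumes "\<sigma> \<in> confs L"
  shows "state_sum L l [] (\<lambda>_. 1) \<sigma> = seed_re L l \<sigma>"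
proof -
  let ?\<tau> = "\<lambda>(v, i). if i = (0::nat) then \<sigma> v else 0"
  have "{\<tau>\<in>spin_set (word_pieces L []). top_conf [] \<tau> = \<sigma>} = {?\<tau>}"
  proof (intro subset_antisym subsetI)
    fix \<tau> assume \<tau>: "\<tau> \<in> {\<tau>\<in>spin_set (word_pieces L []). top_conf [] \<tau> = \<sigma>}"
    have "\<tau> (v, i) = ?\<tau> (v, i)" for v i
      using \<tau> by (cases "i = 0") (auto simp: top_conf_def touching_def spin_set_def word_pieces_def)
    then show "\<tau> \<in> {?\<tau>}" by auto
  next
    fix \<tau> assume "\<tau> \<in> {?\<tau>}"
    then show "\<tau> \<in> {\<tau>\<in>spin_set (word_pieces L []). top_conf [] \<tau> = \<sigma>}"
      using assms by (auto simp: top_conf_def touching_def spin_set_def word_pieces_def confs_def)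
  qed
  then show ?thesis
    by (simp add: state_sum_def links_weight_def open_links_def seed_re_caps o_def)
qed

lemma state_sum_append:
  assumes "set (r @ q) \<subseteq> edges L" and \<sigma>: "\<sigma> \<in> confs L"
    and g: "\<And>r' u \<tau> a b. g (\<tau>((u, Suc (touching (r' @ q) u)) := a, (u + 1, Suc (touching (r' @ q) (u + 1))) := b)) = g \<tau>"
  shows "state_sum L l (r @ q) g \<sigma> = foldr (tl_act L l) r (state_sum L l q g) \<sigma>"
  using assms(1) \<sigma>
proof (induction r arbitrary: \<sigma>)
  case (Cons u r)
  have "state_sum L l (u # r @ q) g \<sigma> = tl_act L l u (state_sum L l (r @ q) g) \<sigma>"
    using Cons.prems by (intro state_sum_Cons g) auto
  also have "\<dots> = tl_act L l u (foldr (tl_act L l) r (state_sum L l q g)) \<sigma>"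
    using Cons by (intro tl_act_cong) auto
  finally show ?case by simp
qed simp

lemma foldr_tl_act_cong:
  assumes "\<And>y. y \<in> confs L \<Longrightarrow> \<phi> y = \<psi> y" "x \<in> confs L"
  shows "foldr (tl_act L l) r \<phi> x = foldr (tl_act L l) r \<psi> x"
  using assms(2)
proof (induction r arbitrary: x)
  case (Cons u r)
  then show ?case by (auto intro: tl_act_cong)
qed (use assms(1) in simp)

text \<open>The top caps have the weights of a second seed vector, so closing the picture is the
  scalar product with the seed; the observable sits between the rungs of \<open>q\<close> and those
  of \<open>r\<close>.\<close>

lemma word_state_sum:
  assumes "set (r @ q) \<subseteq> edges L"
  shows "(\<Sum>\<tau>\<in>spin_set (word_pieces L (r @ q)). links_weight l (all_links L (r @ q)) \<tau> * f (top_conf q \<tau>))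
    = (\<Sum>\<sigma>\<in>confs L. seed_re L l \<sigma> *
        foldr (tl_act L l) r (\<lambda>z. f z * foldr (tl_act L l) q (seed_re L l) z) \<sigma>)"
proof -
  let ?g = "\<lambda>\<tau>. f (top_conf q \<tau>)"
  have split: "links_weight l (all_links L (r @ q)) \<tau> = seed_re L l (top_conf (r @ q) \<tau>) * links_weight l (open_links L (r @ q)) \<tau>" for \<tau>
    by (simp add: links_weight_def all_links_def seed_re_caps top_conf_def o_def)
  \<comment> \<open>A piece created after \<open>q\<close> has an index above
    \<open>touching q u\<close>, so the row read by \<open>f\<close> is unaffected.\<close>
  have g: "?g (\<tau>((u, Suc (touching (r' @ q) u)) := a, (u + 1, Suc (touching (r' @ q) (u + 1))) := b)) = ?g \<tau>" for r' u \<tau> a b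
    by (intro arg_cong[of _ _ f]) (auto simp: top_conf_def fun_eq_iff touching_append)
  have base: "state_sum L l q ?g z = f z * foldr (tl_act L l) q (seed_re L l) z" if "z \<in> confs L" for z
  proof -
    have "state_sum L l q ?g z = f z * state_sum L l q (\<lambda>_. 1) z"
      by (auto simp: state_sum_def sum_distrib_left intro!: sum.cong)
    also have "state_sum L l q (\<lambda>_. 1) z = foldr (tl_act L l) q (state_sum L l [] (\<lambda>_. 1)) z"
      using state_sum_append[of q "[]" L z "\<lambda>_. 1" l] assms that by simp
    also have "\<dots> = foldr (tl_act L l) q (seed_re L l) z"
      by (rule foldr_tl_act_cong[OF state_sum_Nil that])
    finally show ?thesis .
  qed
  have "(\<Sum>\<tau>\<in>spin_set (word_pieces L (r @ q)). links_weight l (all_links L (r @ q)) \<tau> * ?g \<tau>)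
    = (\<Sum>\<sigma>\<in>confs L. seed_re L l \<sigma> * state_sum L l (r @ q) ?g \<sigma>)"
    unfolding sum_top_conf split by (simp add: mult.assoc)
  also have "\<dots> = (\<Sum>\<sigma>\<in>confs L. seed_re L l \<sigma> * foldr (tl_act L l) r (state_sum L l q ?g) \<sigma>)"
    by (intro sum.cong refl) (simp add: state_sum_append[OF assms _ g])
  also have "\<dots> = (\<Sum>\<sigma>\<in>confs L. seed_re L l \<sigma> *
        foldr (tl_act L l) r (\<lambda>z. f z * foldr (tl_act L l) q (seed_re L l) z) \<sigma>)"
    by (intro sum.cong refl arg_cong2[of _ _ _ _ "(*)"] foldr_tl_act_cong base)
  finally show ?thesis .
qed

lemma sum_words_foldr:
  "(\<Sum>r\<in>words L n. foldr (tl_act L l) r \<phi> x) = (tl_sum L l ^^ n) \<phi> x"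
proof (induction n arbitrary: x)
  case 0
  have "words L 0 = {[]}" by (auto simp: words_def)
  then show ?case by simp
next
  case (Suc n)
  have "(\<Sum>r\<in>words L (Suc n). foldr (tl_act L l) r \<phi> x) =
    (\<Sum>(u, r)\<in>edges L \<times> words L n. tl_act L l u (foldr (tl_act L l) r \<phi>) x)"
    by (rule sum.reindex_bij_witness[of _ "\<lambda>(u, r). u # r" "\<lambda>r. (hd r, tl r)"])
       (auto simp: words_def length_Suc_conv)
  also have "\<dots> = (\<Sum>u\<in>edges L. \<Sum>r\<in>words L n. tl_act L l u (foldr (tl_act L l) r \<phi>) x)"
    by (simp add: sum.cartesian_product)
  also have "\<dots> = (\<Sum>u\<in>edges L. tl_act L l u (\<lambda>y. \<Sum>r\<in>words L n. foldr (tl_act L l) r \<phi> y) x)"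
    unfolding tl_act_def sum_distrib_left by (intro sum.cong refl sum.swap)
  also have "\<dots> = (tl_sum L l ^^ Suc n) \<phi> x"
    by (simp only: Suc.IH funpow.simps(2) o_apply tl_sum_def[of L l "(tl_sum L l ^^ n) \<phi>" x])
  finally show ?case .
qed

lemma sum_words_state_sum:
  "(\<Sum>r\<in>words L m. \<Sum>q\<in>words L k. \<Sum>\<tau>\<in>spin_set (word_pieces L (r @ q)).
      links_weight l (all_links L (r @ q)) \<tau> * f (top_conf q \<tau>)) = tl_elem L l f m k"
proof -
  let ?\<psi> = "\<lambda>q z. f z * foldr (tl_act L l) q (seed_re L l) z"
  have "(\<Sum>r\<in>words L m. \<Sum>q\<in>words L k. \<Sum>\<tau>\<in>spin_set (word_pieces L (r @ q)).
      links_weight l (all_links L (r @ q)) \<tau> * f (top_conf q \<tau>))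
    = (\<Sum>r\<in>words L m. \<Sum>q\<in>words L k. \<Sum>\<sigma>\<in>confs L. seed_re L l \<sigma> * foldr (tl_act L l) r (?\<psi> q) \<sigma>)"
    by (intro sum.cong refl word_state_sum) (auto simp: words_def)
  also have "\<dots> = (\<Sum>q\<in>words L k. \<Sum>\<sigma>\<in>confs L. \<Sum>r\<in>words L m. seed_re L l \<sigma> * foldr (tl_act L l) r (?\<psi> q) \<sigma>)"
    by (subst sum.swap) (intro sum.cong refl sum.swap)
  also have "\<dots> = (\<Sum>q\<in>words L k. \<Sum>\<sigma>\<in>confs L. seed_re L l \<sigma> * (tl_sum L l ^^ m) (?\<psi> q) \<sigma>)"
    by (simp add: sum_words_foldr flip: sum_distrib_left)
  also have "\<dots> = (\<Sum>\<sigma>\<in>confs L. seed_re L l \<sigma> * (\<Sum>q\<in>words L k. (tl_sum L l ^^ m) (?\<psi> q) \<sigma>))"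
    by (subst sum.swap) (simp add: sum_distrib_left)
  also have "\<dots> = (\<Sum>\<sigma>\<in>confs L. seed_re L l \<sigma> * (tl_sum L l ^^ m) (\<lambda>z. f z * (tl_sum L l ^^ k) (seed_re L l) z) \<sigma>)"
  proof (intro sum.cong refl arg_cong2[of _ _ _ _ "(*)"])
    fix \<sigma> assume \<sigma>: "\<sigma> \<in> confs L"
    let ?d = "\<lambda>z. (tl_sum L l ^^ m) (\<lambda>y. if y = z then 1 else 0) \<sigma>"
    have "(\<Sum>q\<in>words L k. (tl_sum L l ^^ m) (?\<psi> q) \<sigma>) = (\<Sum>q\<in>words L k. \<Sum>z\<in>confs L. ?\<psi> q z * ?d z)"
      by (intro sum.cong refl tl_pow_expand[OF \<sigma>])
    also have "\<dots> = (\<Sum>z\<in>confs L. \<Sum>q\<in>words L k. ?\<psi> q z * ?d z)" by (rule sum.swap)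
    also have "\<dots> = (\<Sum>z\<in>confs L. (f z * (tl_sum L l ^^ k) (seed_re L l) z) * ?d z)"
      by (intro sum.cong refl)
         (simp add: sum_words_foldr[where n = k and \<phi> = "seed_re L l", symmetric] sum_distrib_left sum_distrib_right)
    also have "\<dots> = (tl_sum L l ^^ m) (\<lambda>z. f z * (tl_sum L l ^^ k) (seed_re L l) z) \<sigma>"
      by (rule tl_pow_expand[OF \<sigma>, symmetric])
    finally show "(\<Sum>q\<in>words L k. (tl_sum L l ^^ m) (?\<psi> q) \<sigma>) = \<dots>" .
  qed
  finally show ?thesis by (simp add: tl_elem_def)
qed

section \<open>The loop representation\<close>

lemma sums_complex_of_real:
  assumes "(\<lambda>n. complex_of_real (a n)) sums B"
  shows "summable a" and "B = complex_of_real (suminf a)"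
proof -
  have "a sums Re B" using sums_Re[OF assms] by simp
  then show "summable a" by (rule sums_summable)
  have "suminf a = Re B" using \<open>a sums Re B\<close> by (rule sums_unique[symmetric])
  with sums_unique2[OF assms sums_of_real[OF \<open>a sums Re B\<close>]]
  show "B = complex_of_real (suminf a)" by simp
qed

lemma spins_at_0_zip:
  assumes "length r = length ts" "length q = length us" "sorted_wrt (>) (ts @ us)"
    and "\<forall>x\<in>set ts. x > 0" "\<forall>x\<in>set us. x < 0"
    and \<tau>: "\<tau> \<in> spin_set (word_pieces L (r @ q))"
  shows "spins_at_0 L (zip (r @ q) (ts @ us)) \<tau> = top_conf q \<tau>"
  using \<tau> by (auto simp: fun_eq_iff spins_at_0_def top_conf_def tidx_0_zip[OF assms(1-5)] spin_set_def word_pieces_def)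

text \<open>The factor 1/n! and the choice of the \<open>k\<close> rungs below time 0 combine to
  1/(k! (n-k)!). With \<open>f\<close> constantly 1 this also yields the normalization.\<close>

lemma rho_int_word_weights:
  assumes \<beta>: "\<beta> > 0" and G: "order_inv G"
    and Z: "\<And>r q ts us. set (r @ q) \<subseteq> edges L \<Longrightarrow> length r = length ts \<Longrightarrow> length q = length us
       \<Longrightarrow> sorted_wrt (>) (ts @ us) \<Longrightarrow> (\<forall>x\<in>set ts. x > 0) \<Longrightarrow> (\<forall>x\<in>set us. x < 0)
       \<Longrightarrow> G (zip (r @ q) (ts @ us)) =
         (\<Sum>\<tau>\<in>spin_set (word_pieces L (r @ q)). links_weight l (all_links L (r @ q)) \<tau> * f (top_conf q \<tau>))"
  shows "rho_int L \<beta> G = (\<Sum>n. exp (- (2 * real L - 1) * \<beta>) *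
    ((\<beta> / 2) ^ n * (\<Sum>k\<le>n. tl_elem L l f (n - k) k / (fact k * fact (n - k)))))"
proof -
  have "(\<Sum>es\<in>words L n. integral\<^sup>L (PiM {..<n} (\<lambda>_. time_measure \<beta>)) (\<lambda>t. G (zip es (map t [0..<n]))))
    = (\<Sum>k\<le>n. real (n choose k) * ((\<beta> / 2) ^ n * tl_elem L l f (n - k) k))" for n
    unfolding sum_words_state_sum[symmetric] by (rule rho_term[OF \<beta> G]) (rule Z, auto)
  moreover have "c / fact n * (\<Sum>k\<le>n. real (n choose k) * ((\<beta> / 2) ^ n * tl_elem L l f (n - k) k))
    = c * ((\<beta> / 2) ^ n * (\<Sum>k\<le>n. tl_elem L l f (n - k) k / (fact k * fact (n - k))))" for n c
    unfolding sum_distrib_left by (intro sum.cong refl) (simp add: binomial_fact)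
  ultimately show ?thesis unfolding rho_int_def by (simp only: words_def[symmetric])
qed

lemma sqrtQ_sign: "s = 1 \<or> s = - 1 \<Longrightarrow> sqrtQ lam = exp (s * lam) + exp (- (s * lam))"
  by (auto simp: sqrtQ_def)

lemma xxz_expect_eq:
  fixes \<beta> lam s :: real and f :: "(int \<Rightarrow> int) \<Rightarrow> real"
  assumes L: "even L" and \<beta>: "\<beta> > 0" and s: "s = 1 \<or> s = - 1"
  shows "xxz_expect L \<beta> lam s (s * lam) (diag_op f) = complex_of_real (mu_int L \<beta> lam (cond_exp L lam s f))"
proof -
  define l where "l = s * lam"
  define c where "c = exp (- (2 * real L - 1) * \<beta>)"
  interpret N: real_op L "scale_op (- \<beta> / 2) (H_XXZ_pm L lam s)" "\<beta> / 2" l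
    using real_op_xxz[OF L s, of "\<beta> / 2" lam] by (simp add: l_def)
  interpret D: real_op L "scale_op (- \<beta>) (H_XXZ_pm L lam s)" \<beta> l
    using real_op_xxz[OF L s, of \<beta> lam] by (simp add: l_def)
  let ?E = "xxz_exp L (scale_op (- \<beta> / 2) (H_XXZ_pm L lam s))"
  define a where "a n = (\<beta> / 2) ^ n * (\<Sum>k\<le>n. tl_elem L l f (n - k) k / (fact k * fact (n - k)))" for n
  define d where "d n = \<beta> ^ n / fact n * tl_elem L l (\<lambda>_. 1) n 0" for n
  note num = sums_complex_of_real[OF N.bra_exp_diag_exp_sums[of f], folded a_def]
  note den = sums_complex_of_real[OF D.bra_exp_sums, folded d_def]
  have lam: "sqrtQ lam = exp (s * lam) + exp (- (s * lam))" by (rule sqrtQ_sign[OF s])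
  have "rho_int L \<beta> (\<lambda>\<omega>. sqrtQ lam ^ num_loops L \<omega> * cond_exp L lam s f \<omega>) = (\<Sum>n. c * a n)"
    unfolding a_def c_def
  proof (rule rho_int_word_weights[OF \<beta>])
    show "order_inv (\<lambda>\<omega>. sqrtQ lam ^ num_loops L \<omega> * cond_exp L lam s f \<omega>)"
      using order_inv_num_loops[of L] order_inv_cond_exp[of L lam s f] unfolding order_inv_def by metis
  next
    fix r q ts us
    assume *: "set (r @ q) \<subseteq> edges L" "length r = length ts" "length q = length us"
       "sorted_wrt (>) (ts @ us)" "\<forall>x\<in>set ts. x > (0::real)" "\<forall>x\<in>set us. x < 0"
    show "sqrtQ lam ^ num_loops L (zip (r @ q) (ts @ us)) * cond_exp L lam s f (zip (r @ q) (ts @ us)) =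
       (\<Sum>\<tau>\<in>spin_set (word_pieces L (r @ q)). links_weight l (all_links L (r @ q)) \<tau> * f (top_conf q \<tau>))"
      by (subst loop_weight_word(2)[OF *(1) _ *(4) lam], simp add: *(2,3), intro sum.cong refl)
         (simp only: links_weight_def l_def spins_at_0_zip[OF *(2-6)])
  qed
  then have numer: "rho_int L \<beta> (\<lambda>\<omega>. sqrtQ lam ^ num_loops L \<omega> * cond_exp L lam s f \<omega>) = c * suminf a"
    using suminf_mult[OF num(1)] by simp
  \<comment> \<open>Without an observable only the total number of rungs matters; the binomial
    coefficients sum to \<open>2 ^ n\<close>, which restores \<beta> from its two halves.\<close>
  have d_eq: "(\<beta> / 2) ^ n * (\<Sum>k\<le>n. tl_elem L l (\<lambda>_. 1) (n - k) k / (fact k * fact (n - k))) = d n" for n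
  proof -
    have "(\<Sum>k\<le>n. tl_elem L l (\<lambda>_. 1) (n - k) k / (fact k * fact (n - k))) =
        (\<Sum>k\<le>n. real (n choose k) * (tl_elem L l (\<lambda>_. 1) n 0 / fact n))"
      by (intro sum.cong refl) (simp add: tl_elem_one[of L l "_ - _"] binomial_fact)
    also have "\<dots> = 2 ^ n * (tl_elem L l (\<lambda>_. 1) n 0 / fact n)"
      unfolding sum_distrib_right[symmetric] of_nat_sum[symmetric] choose_row_sum by simp
    finally show ?thesis by (simp add: d_def power_divide)
  qed
  have "rho_int L \<beta> (\<lambda>\<omega>. sqrtQ lam ^ num_loops L \<omega>) = (\<Sum>n. c * d n)"
    unfolding d_eq[symmetric] c_def
  proof (rule rho_int_word_weights[OF \<beta>])
    show "order_inv (\<lambda>\<omega>. sqrtQ lam ^ num_loops L \<omega>)"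
      using order_inv_num_loops[of L] unfolding order_inv_def by metis
  next
    fix r q ts us
    assume *: "set (r @ q) \<subseteq> edges L" "length r = length ts" "length q = length us"
       "sorted_wrt (>) (ts @ us)" "\<forall>x\<in>set ts. x > (0::real)" "\<forall>x\<in>set us. x < 0"
    then show "sqrtQ lam ^ num_loops L (zip (r @ q) (ts @ us)) =
       (\<Sum>\<tau>\<in>spin_set (word_pieces L (r @ q)). links_weight l (all_links L (r @ q)) \<tau> * 1)"
      by (subst loop_weight_word(1)[OF *(1) _ *(4) lam])
         (simp_all add: links_weight_def l_def)
  qed
  then have denom: "rho_int L \<beta> (\<lambda>\<omega>. sqrtQ lam ^ num_loops L \<omega>) = c * suminf d"
    using suminf_mult[OF den(1)] by simp
  have "xxz_expect L \<beta> lam s l (diag_op f) = complex_of_real (suminf a) / complex_of_real (suminf d)"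
    by (simp only: xxz_expect_def Let_def num(2) den(2))
  \<comment> \<open>The nonzero factor \<open>c\<close> is common to both Poisson integrals and may
    be inserted above and below.\<close>
  also have "\<dots> = complex_of_real (c * suminf a / (c * suminf d))"
    by (simp add: c_def)
  finally show ?thesis unfolding mu_int_def numer denom l_def .
qed

theorem theorem4p2:
  fixes L :: nat and \<beta> lam :: real and f :: "(int \<Rightarrow> int) \<Rightarrow> real"
  assumes "lam \<ge> 0" and "even L" and "\<beta> > 0"
  shows "xxz_expect L \<beta> lam 1 lam (diag_op f)
           = complex_of_real (mu_int L \<beta> lam (cond_exp L lam 1 f))
       \<and> xxz_expect L \<beta> lam (-1) (- lam) (diag_op f)
           = complex_of_real (mu_int L \<beta> lam (cond_exp L lam (-1) f))"
  using xxz_expect_eq[OF assms(2,3), of 1 lam f] xxz_expect_eq[OF assms(2,3), of "- 1" lam f] by simp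

end
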